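(* Let $G$ be a connected Lie group, let $R$ be the radical of $G$, and let $k>0$ be an integer. Then the map $P_k:G\to G$, $g\mapsto g^k$, has dense image if and only if the map $P_k:G/R\to G/R$, $x\mapsto x^k$, has dense image.
   Context: Lie groups are real and finite-dimensional. The radical of $G$ is its solvable radical, i.e. the maximal connected solvable normal subgroup of $G$. *)

theory Defs
  imports "HOL-Analysis.Analysis" "HOL-Algebra.Solvable_Groups"
begin

section \<open>Smooth maps between subsets of Euclidean spaces\<close>

fun times_cont_diff_on :: "nat \<Rightarrow> 'e::real_normed_vector set \<Rightarrow> ('e \<Rightarrow> 'f::real_normed_vector) \<Rightarrow> bool"
  where
    "times_cont_diff_on 0 S f \<longleftrightarrow> continuous_on S f"
  | "times_cont_diff_on (Suc n) S f \<longleftrightarrow>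
       (\<forall>x\<in>S. f differentiable (at x)) \<and>
       (\<forall>v. times_cont_diff_on n S (\<lambda>x. frechet_derivative f (at x) v))"

text \<open>For a subset that need not be open, smooth means: locally the restriction of a
  \<open>C\<^sup>\<infinity>\<close> map on an open set. On open sets this is the usual \<open>C\<^sup>\<infinity>\<close>; on a relatively open
  subset of a linear subspace it is \<open>C\<^sup>\<infinity>\<close> on that subspace.\<close>

definition smooth_on :: "'e::euclidean_space set \<Rightarrow> ('e \<Rightarrow> 'f::euclidean_space) \<Rightarrow> bool"
  where "smooth_on S f \<longleftrightarrow>
    (\<forall>x\<in>S. \<exists>W F. open W \<and> x \<in> W \<and> (\<forall>n. times_cont_diff_on n W F) \<and>
                 (\<forall>y\<in>S \<inter> W. F y = f y))"


section \<open>Smooth manifolds\<close>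

text \<open>A chart consists of its domain and the coordinate map. Charts take values in relatively
  open subsets of a linear subspace \<open>V\<close> of a Euclidean space; the dimension of the manifold is
  \<open>dim V\<close>. The subspace is there because Euclidean types have positive dimension: \<open>V = {0}\<close>
  gives the manifolds of dimension zero.\<close>

type_synonym ('a, 'e) chart = "'a set \<times> ('a \<Rightarrow> 'e)"

definition is_chart :: "'a topology \<Rightarrow> 'e::euclidean_space set \<Rightarrow> ('a, 'e) chart \<Rightarrow> bool"
  where "is_chart T V c \<longleftrightarrow> (case c of (U, \<phi>) \<Rightarrow>
    openin T U \<and> openin (top_of_set V) (\<phi> ` U) \<and>
    homeomorphic_map (subtopology T U) (top_of_set (\<phi> ` U)) \<phi>)"

definition smooth_atlas ::
    "'a topology \<Rightarrow> 'e::euclidean_space set \<Rightarrow> ('a, 'e) chart set \<Rightarrow> bool"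
  where "smooth_atlas T V A \<longleftrightarrow>
    (\<forall>c\<in>A. is_chart T V c) \<and> (\<Union>(U, \<phi>)\<in>A. U) = topspace T \<and>
    (\<forall>(U, \<phi>)\<in>A. \<forall>(W, \<psi>)\<in>A. smooth_on (\<phi> ` (U \<inter> W)) (\<psi> \<circ> inv_into U \<phi>))"

definition smooth_manifold :: "'a topology \<Rightarrow> ('a, 'e::euclidean_space) chart set \<Rightarrow> bool"
  where "smooth_manifold T A \<longleftrightarrow>
    Hausdorff_space T \<and> second_countable T \<and> (\<exists>V. subspace V \<and> smooth_atlas T V A)"

definition product_atlas ::
    "('a, 'e) chart set \<Rightarrow> ('b, 'f) chart set \<Rightarrow> ('a \<times> 'b, 'e \<times> 'f) chart set"
  where "product_atlas A B = {(U \<times> W, map_prod \<phi> \<psi>) | U \<phi> W \<psi>. (U, \<phi>) \<in> A \<and> (W, \<psi>) \<in> B}"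

definition smooth_map ::
    "'a topology \<Rightarrow> ('a, 'e::euclidean_space) chart set \<Rightarrow>
     'b topology \<Rightarrow> ('b, 'f::euclidean_space) chart set \<Rightarrow> ('a \<Rightarrow> 'b) \<Rightarrow> bool"
  where "smooth_map T A T' B f \<longleftrightarrow>
    continuous_map T T' f \<and>
    (\<forall>(U, \<phi>)\<in>A. \<forall>(W, \<psi>)\<in>B. smooth_on (\<phi> ` (U \<inter> f -` W)) (\<psi> \<circ> f \<circ> inv_into U \<phi>))"


section \<open>Lie groups\<close>

definition lie_group ::
    "('a, 'm) monoid_scheme \<Rightarrow> 'a topology \<Rightarrow> ('a, 'e::euclidean_space) chart set \<Rightarrow> bool"
  where "lie_group G T A \<longleftrightarrow>
    group G \<and> topspace T = carrier G \<and> smooth_manifold T A \<and>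
    smooth_map (prod_topology T T) (product_atlas A A) T A (\<lambda>(x, y). x \<otimes>\<^bsub>G\<^esub> y) \<and>
    smooth_map T A T A (\<lambda>x. inv\<^bsub>G\<^esub> x)"

definition connected_solvable_normal ::
    "('a, 'm) monoid_scheme \<Rightarrow> 'a topology \<Rightarrow> 'a set \<Rightarrow> bool"
  where "connected_solvable_normal G T N \<longleftrightarrow>
    N \<lhd> G \<and> solvable (G\<lparr>carrier := N\<rparr>) \<and> connectedin T N"

text \<open>Maximality is with respect to inclusion. In a Lie group the product of two connected solvable
  normal subgroups is again one, so exactly one subgroup satisfies this predicate.\<close>

definition is_radical :: "('a, 'm) monoid_scheme \<Rightarrow> 'a topology \<Rightarrow> 'a set \<Rightarrow> bool"
  where "is_radical G T R \<longleftrightarrow>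
    connected_solvable_normal G T R \<and>
    (\<forall>N. connected_solvable_normal G T N \<longrightarrow> R \<subseteq> N \<longrightarrow> N = R)"


section \<open>Quotient topology and dense image\<close>

definition quotient_topology :: "'a topology \<Rightarrow> ('a \<Rightarrow> 'b) \<Rightarrow> 'b topology"
  where "quotient_topology T q =
    topology (\<lambda>U. U \<subseteq> q ` topspace T \<and> openin T {x \<in> topspace T. q x \<in> U})"

lemma openin_quotient_topology:
  "openin (quotient_topology T q) U \<longleftrightarrow>
     U \<subseteq> q ` topspace T \<and> openin T {x \<in> topspace T. q x \<in> U}"
proof -
  let ?P = "\<lambda>U. {x \<in> topspace T. q x \<in> U}"
  have "?P (S \<inter> S') = ?P S \<inter> ?P S'" for S S' by blast
  moreover have "?P (\<Union>K) = \<Union>(?P ` K)" for K by blast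
  ultimately have "istopology (\<lambda>U. U \<subseteq> q ` topspace T \<and> openin T (?P U))"
    by (simp only: istopology_def) (auto simp del: UN_simps intro!: openin_Union)
  then show ?thesis
    by (simp add: quotient_topology_def topology_inverse')
qed

lemma topspace_quotient_topology [simp]: "topspace (quotient_topology T q) = q ` topspace T"
proof -
  have "{x \<in> topspace T. q x \<in> q ` topspace T} = topspace T" by blast
  then have "openin (quotient_topology T q) (q ` topspace T)"
    by (simp add: openin_quotient_topology)
  then have "q ` topspace T \<subseteq> topspace (quotient_topology T q)"
    by (rule openin_subset)
  moreover have "topspace (quotient_topology T q) \<subseteq> q ` topspace T"
    using openin_topspace[of "quotient_topology T q"] openin_quotient_topology[of T q] by blast
  ultimately show ?thesis by blast
qed

lemma quotient_map_quotient_topology: "quotient_map T (quotient_topology T q) q"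
  by (simp add: quotient_map_def openin_quotient_topology)

definition coset_topology :: "('a, 'm) monoid_scheme \<Rightarrow> 'a topology \<Rightarrow> 'a set \<Rightarrow> 'a set topology"
  where "coset_topology G T N = quotient_topology T (\<lambda>g. N #>\<^bsub>G\<^esub> g)"

definition has_dense_image :: "'a topology \<Rightarrow> ('a \<Rightarrow> 'a) \<Rightarrow> bool"
  where "has_dense_image T f \<longleftrightarrow> T closure_of (f ` topspace T) = topspace T"

end

(*
  Lie theory enters only through a chart at the identity. For a subgroup H let tangent_space H be the
  set of initial velocities of curves in H starting at the identity; it is a linear subspace, and a
  closed subgroup of a connected subgroup M with the same tangent space as M is all of M.

  Density of the k-th powers modulo R passes down the closures of the derived series of R, so let N
  be one of these closures and N' the next one. Since (m x)^k = c(m) x^k, where c(m) is the product of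
  the x^i m x^(-i) for i < k, and c is a homomorphism modulo N' on N, the closure H of N' c(N) is a
  subgroup of N. Its tangent space contains L_x v = sum of (Ad x)^i v over i < k for all v tangent to
  N. If L_x is invertible on the tangent space of N, then H = N and m x^k is a limit of elements
  m' (n x)^k with m' in N'.

  Such x are dense: det L_x is a polynomial in matrix coefficients of Ad, so its translates span a
  finite-dimensional space of functions, and such a function on a connected group that vanishes on a
  nonempty open set is zero; but L_1 is multiplication by k > 0.
*)
theory Submission
  imports Defs "Jordan_Normal_Form.Determinant"
begin

text \<open>Density modulo \<open>N\<close> puts some m x^k near any target, with no control over m
  in \<open>N\<close>. The freedom left is to move x inside its coset, and (n x)^k = c(n) x^k
  reaches m only if c(N) is large modulo \<open>N'\<close>. For special x it is tiny: in the
  orientation-preserving motions of the plane, with \<open>N\<close> the translations and x a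
  rotation by 2 pi / k, k > 1, the sum L_x is zero and c is constant. Hence x is perturbed before m
  is absorbed. Meanwhile m stays fixed, because the x with m x^k in a given open set form an open
  set. Solvability enters because c is multiplicative only modulo commutators of \<open>N\<close>.
  Closures enter because neither the derived subgroups nor \<open>N'\<close> c(N) need be closed,
  while equal tangent spaces identify only closed subgroups. Integer powers of small elements act as
  one-parameter subgroups in that identification.\<close>

no_notation Matrix.scalar_prod (infix "\<bullet>" 70)

section \<open>Groups with continuous operations\<close>

locale continuous_group = group G for G (structure) +
  fixes T :: "'a topology"
  assumes topspace_eq [simp]: "topspace T = carrier G"
    and continuous_mult: "continuous_map (prod_topology T T) T (\<lambda>(x, y). x \<otimes> y)"
    and continuous_inv: "continuous_map T T (\<lambda>x. inv x)"
begin

lemma continuous_map_mult: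
  assumes "continuous_map X T f" "continuous_map X T g"
  shows "continuous_map X T (\<lambda>x. f x \<otimes> g x)"
  using continuous_map_compose[OF continuous_map_pairedI[OF assms] continuous_mult]
  by (simp add: o_def)

lemma continuous_map_inv:
  assumes "continuous_map X T f"
  shows "continuous_map X T (\<lambda>x. inv (f x))"
  using continuous_map_compose[OF assms continuous_inv] by (simp add: o_def)

lemma continuous_map_nat_pow:
  assumes "continuous_map X T f"
  shows "continuous_map X T (\<lambda>x. f x [^] (n::nat))"
  by (induction n) (auto intro!: continuous_map_mult assms)

lemma openin_preimage_ltrans:
  assumes "openin T W0" "x \<in> carrier G"
  shows "openin T {y \<in> carrier G. x \<otimes> y \<in> W0}"
proof -
  have "continuous_map T T (\<lambda>y. x \<otimes> y)"
    using assms(2) by (intro continuous_map_mult) auto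
  from openin_continuous_map_preimage[OF this assms(1)] show ?thesis by simp
qed

lemma openin_preimage_rtrans:
  assumes "openin T W0" "x \<in> carrier G"
  shows "openin T {y \<in> carrier G. y \<otimes> x \<in> W0}"
proof -
  have "continuous_map T T (\<lambda>y. y \<otimes> x)"
    using assms(2) by (intro continuous_map_mult) auto
  from openin_continuous_map_preimage[OF this assms(1)] show ?thesis by simp
qed

lemma openin_preimage_inv:
  assumes "openin T W0"
  shows "openin T {y \<in> carrier G. inv y \<in> W0}"
  using openin_continuous_map_preimage[OF continuous_inv assms] by simp

lemma rtrans_neighbourhood:
  assumes O: "openin T W0" "x \<in> W0"
  obtains W where "openin T W" "\<one> \<in> W" "\<And>y. y \<in> W \<Longrightarrow> x \<otimes> y \<in> W0" "\<And>y. y \<in> W \<Longrightarrow> x \<otimes> inv y \<in> W0"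
proof
  have x: "x \<in> carrier G" using openin_subset[OF O(1)] O(2) by auto
  let ?W = "{y \<in> carrier G. x \<otimes> y \<in> W0}"
  show "openin T (?W \<inter> {y \<in> carrier G. inv y \<in> ?W})"
    using O x by (intro openin_Int openin_preimage_inv openin_preimage_ltrans)
  show "\<one> \<in> ?W \<inter> {y \<in> carrier G. inv y \<in> ?W}"
    using O x by auto
qed auto

lemma division_neighbourhood:
  assumes "openin T W" "\<one> \<in> W"
  obtains V where "openin T V" "\<one> \<in> V" "\<And>x y. x \<in> V \<Longrightarrow> y \<in> V \<Longrightarrow> inv x \<otimes> y \<in> W"
proof -
  let ?f = "\<lambda>p. inv (fst p) \<otimes> snd p"
  have "continuous_map (prod_topology T T) T ?f"
    by (intro continuous_map_mult continuous_map_inv continuous_map_fst continuous_map_snd)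
  from openin_continuous_map_preimage[OF this assms(1)]
  have "openin (prod_topology T T) {p \<in> carrier G \<times> carrier G. ?f p \<in> W}" by simp
  moreover have "(\<one>, \<one>) \<in> {p \<in> carrier G \<times> carrier G. ?f p \<in> W}" using assms by simp
  ultimately have "\<exists>V1 V2. openin T V1 \<and> openin T V2 \<and> \<one> \<in> V1 \<and> \<one> \<in> V2 \<and>
      V1 \<times> V2 \<subseteq> {p \<in> carrier G \<times> carrier G. ?f p \<in> W}"
    by (simp only: openin_prod_topology_alt)
  then obtain V1 V2 where V: "openin T V1" "openin T V2" "\<one> \<in> V1" "\<one> \<in> V2"
      "V1 \<times> V2 \<subseteq> {p \<in> carrier G \<times> carrier G. ?f p \<in> W}"
    by (elim exE conjE)
  show thesis
  proof
    show "openin T (V1 \<inter> V2)" "\<one> \<in> V1 \<inter> V2" using V by auto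
    show "inv x \<otimes> y \<in> W" if "x \<in> V1 \<inter> V2" "y \<in> V1 \<inter> V2" for x y
    proof -
      have "(x, y) \<in> V1 \<times> V2" using that by blast
      with V(5) show ?thesis by auto
    qed
  qed
qed

text \<open>\<open>S\<close> and its complement in \<open>M\<close> are both relatively open, so
  connectedness leaves only \<open>S\<close>. As \<open>S\<close> is merely asked to absorb small
  right factors, this serves as an induction principle: for points with a vanishing germ, for
  elements whose conjugation acts linearly on velocities, and for closed subgroups.\<close>

lemma connected_subgroup_induct:
  assumes M: "subgroup M G" "connectedin T M"
    and O: "openin T W0" "\<one> \<in> W0"
    and S: "S \<subseteq> M" "\<one> \<in> S"
    and step: "\<And>x y. x \<in> S \<Longrightarrow> y \<in> M \<inter> W0 \<Longrightarrow> x \<otimes> y \<in> S"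
  shows "S = M"
proof (rule ccontr)
  assume "S \<noteq> M"
  interpret M: subgroup M G by fact
  define P where "P = W0 \<inter> {y \<in> carrier G. inv y \<in> W0}"
  have P: "openin T P" "\<one> \<in> P" 
    unfolding P_def using O by (auto intro: openin_preimage_inv)
  have inM: "inv x \<otimes> y \<in> M" if "x \<in> M" "y \<in> M" for x y
    using that by auto
  define N where "N x = {y \<in> carrier G. inv x \<otimes> y \<in> P}" for x
  have N: "openin T (N x)" "x \<in> N x" if "x \<in> M" for x
    unfolding N_def using that P by (auto intro: openin_preimage_ltrans)
  let ?E1 = "\<Union>x\<in>S. N x" and ?E2 = "\<Union>x\<in>M - S. N x"
  have fwd: "y \<in> S" if "x \<in> S" "y \<in> M" "y \<in> N x" for x y
  proof -
    have "x \<otimes> (inv x \<otimes> y) \<in> S"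
      using that S by (intro step) (auto simp: N_def P_def)
    moreover have "x \<otimes> (inv x \<otimes> y) = y"
      using that S by (metis M.mem_carrier inv_solve_left subsetD inM)
    ultimately show ?thesis by simp
  qed
  \<comment> \<open>Symmetry of \<open>P\<close> makes the complement open: x is y times the inverse
    of a small element, which is again small.\<close>
  have bwd: "x \<in> S" if "x \<in> M" "y \<in> S" "y \<in> N x" for x y
  proof -
    have c: "x \<in> carrier G" "y \<in> carrier G" using that S by auto
    have "inv (inv x \<otimes> y) \<in> M \<inter> W0"
      using that S by (auto simp: N_def P_def)
    then have "y \<otimes> inv (inv x \<otimes> y) \<in> S" using that by (intro step) auto
    moreover have "y \<otimes> inv (inv x \<otimes> y) = x"
      using c by (simp add: inv_mult_group m_assoc[symmetric])
    ultimately show ?thesis by simp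
  qed
  have "openin T ?E1 \<and> openin T ?E2 \<and> M \<subseteq> ?E1 \<union> ?E2 \<and> ?E1 \<inter> ?E2 \<inter> M = {} \<and>
      ?E1 \<inter> M \<noteq> {} \<and> ?E2 \<inter> M \<noteq> {}"
  proof (intro conjI)
    show "openin T ?E1" "openin T ?E2" using N S by auto
    show "M \<subseteq> ?E1 \<union> ?E2" using N by auto
    show "?E1 \<inter> ?E2 \<inter> M = {}" using fwd bwd S by blast
    show "?E1 \<inter> M \<noteq> {}" using N S by blast
    show "?E2 \<inter> M \<noteq> {}" using N S \<open>S \<noteq> M\<close> by blast
  qed
  then have "\<exists>E1 E2. openin T E1 \<and> openin T E2 \<and> M \<subseteq> E1 \<union> E2 \<and> E1 \<inter> E2 \<inter> M = {} \<and>
      E1 \<inter> M \<noteq> {} \<and> E2 \<inter> M \<noteq> {}"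
    by (intro exI[of _ ?E1] exI[of _ ?E2])
  then show False using M(2) by (simp only: connectedin simp_thms)
qed

section \<open>Closures of subgroups and of commutators\<close>

lemma closure_of_image2:
  assumes "continuous_map (prod_topology T T) T (\<lambda>(x, y). f x y)"
    and "\<And>x y. x \<in> A \<Longrightarrow> y \<in> B \<Longrightarrow> f x y \<in> C"
    and "x \<in> T closure_of A" "y \<in> T closure_of B"
  shows "f x y \<in> T closure_of C"
proof -
  have "(\<lambda>(x, y). f x y) ` (prod_topology T T closure_of (A \<times> B)) \<subseteq> T closure_of C"
    using continuous_map_image_closure_subset[OF assms(1), of "A \<times> B"]
      closure_of_mono[of "(\<lambda>(x, y). f x y) ` (A \<times> B)" C T] assms(2) by fastforce
  then show ?thesis using assms(3,4) by (force simp: closure_of_Times)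
qed

lemma closure_of_image1:
  assumes "continuous_map T T f" "\<And>x. x \<in> A \<Longrightarrow> f x \<in> C" "x \<in> T closure_of A"
  shows "f x \<in> T closure_of C"
  using continuous_map_image_closure_subset[OF assms(1), of A]
    closure_of_mono[of "f ` A" C T] assms(2,3) by blast

lemma subgroup_closure_of:
  assumes "subgroup H G"
  shows "subgroup (T closure_of H) G"
proof
  interpret H: subgroup H G by fact
  show "T closure_of H \<subseteq> carrier G"
    using closure_of_subset_topspace[of T H] by simp
  show "\<one> \<in> T closure_of H"
    using closure_of_subset[of H T] H.subset by auto
  show "x \<otimes> y \<in> T closure_of H" if "x \<in> T closure_of H" "y \<in> T closure_of H" for x y
    by (rule closure_of_image2[OF continuous_mult _ that]) auto
  show "inv x \<in> T closure_of H" if "x \<in> T closure_of H" for x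
    by (rule closure_of_image1[OF continuous_inv _ that]) auto
qed

lemma normal_closure_of:
  assumes "N \<lhd> G"
  shows "T closure_of N \<lhd> G"
  unfolding normal_inv_iff
proof (intro conjI ballI)
  show "subgroup (T closure_of N) G"
    using assms normal_imp_subgroup subgroup_closure_of by blast
  show "x \<otimes> h \<otimes> inv x \<in> T closure_of N" if "x \<in> carrier G" "h \<in> T closure_of N" for x h
  proof (rule closure_of_image1[OF _ _ that(2)])
    show "continuous_map T T (\<lambda>h. x \<otimes> h \<otimes> inv x)"
      using that by (intro continuous_map_mult) auto
    show "x \<otimes> h \<otimes> inv x \<in> N" if "h \<in> N" for h
      using assms \<open>x \<in> carrier G\<close> that normal_inv_iff by blast
  qed
qed

lemma continuous_map_commutator:
  "continuous_map (prod_topology T T) T (\<lambda>(x, y). x \<otimes> y \<otimes> inv x \<otimes> inv y)"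
proof -
  have "continuous_map (prod_topology T T) T (\<lambda>p. fst p \<otimes> snd p \<otimes> inv (fst p) \<otimes> inv (snd p))"
    by (intro continuous_map_mult continuous_map_inv continuous_map_fst continuous_map_snd)
  then show ?thesis by (simp add: case_prod_unfold)
qed

lemma commutator_closure_of:
  assumes "x \<in> T closure_of H" "y \<in> T closure_of H"
  shows "x \<otimes> y \<otimes> inv x \<otimes> inv y \<in> T closure_of derived G H"
  by (rule closure_of_image2[OF continuous_map_commutator _ assms])
    (auto simp: derived_def intro!: generate.incl)

section \<open>Connectedness of generated and derived subgroups\<close>

lemma connectedin_ltrans:
  assumes "connectedin T S" "x \<in> carrier G"
  shows "connectedin T ((\<lambda>y. x \<otimes> y) ` S)"
  using assms by (intro connectedin_continuous_map_image[OF _ assms(1)] continuous_map_mult) auto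

text \<open>Every element shares a connected set with \<one>: for a product, \<open>C\<close> and
  the translate of \<open>D\<close> by \<open>h1\<close> overlap in \<open>h1\<close>. Stability
  under inverses lets \<open>S\<close> itself serve for inverse generators.\<close>

lemma connectedin_generate:
  assumes S: "connectedin T S" "\<one> \<in> S"
    and inv: "\<And>x. x \<in> S \<Longrightarrow> inv x \<in> S"
  shows "connectedin T (generate G S)"
proof -
  have SG: "S \<subseteq> carrier G" using connectedin_subset_topspace[OF S(1)] by simp
  have "\<exists>C. connectedin T C \<and> \<one> \<in> C \<and> x \<in> C \<and> C \<subseteq> generate G S"
    if "x \<in> generate G S" for x
    using that
  proof (induction rule: generate.induct)
    case one
    then show ?case using S SG by (intro exI[of _ S]) (auto intro: generate.incl)
  next
    case (incl h)
    then show ?case using S SG by (intro exI[of _ S]) (auto intro: generate.incl)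
  next
    case (inv h)
    then show ?case using S SG assms(3) by (intro exI[of _ S]) (auto intro: generate.incl)
  next
    case (eng h1 h2)
    then obtain C D where C: "connectedin T C" "\<one> \<in> C" "h1 \<in> C" "C \<subseteq> generate G S"
      and D: "connectedin T D" "\<one> \<in> D" "h2 \<in> D" "D \<subseteq> generate G S" by blast
    have h1: "h1 \<in> carrier G" using generate_in_carrier[OF SG] eng by blast
    let ?E = "C \<union> (\<lambda>y. h1 \<otimes> y) ` D"
    have "h1 \<in> (\<lambda>y. h1 \<otimes> y) ` D" using D h1 by force
    then have "connectedin T ?E"
      using C D h1 by (intro connectedin_Un connectedin_ltrans) auto
    moreover have "?E \<subseteq> generate G S"
      using C D eng by (auto intro: generate.eng)
    ultimately show ?case using C D by (intro exI[of _ ?E]) auto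
  qed
  then obtain C where C: "\<And>x. x \<in> generate G S \<Longrightarrow>
      connectedin T (C x) \<and> \<one> \<in> C x \<and> x \<in> C x \<and> C x \<subseteq> generate G S"
    by metis
  have "connectedin T (\<Union>(C ` generate G S))"
    using C by (intro connectedin_Union) auto
  moreover have "\<Union>(C ` generate G S) = generate G S" using C by blast
  ultimately show ?thesis by simp
qed

text \<open>The commutators are a continuous image of H x H, and inverting a commutator swaps its
  two entries.\<close>

lemma connectedin_derived:
  assumes H: "subgroup H G" "connectedin T H"
  shows "connectedin T (derived G H)"
proof -
  interpret H: subgroup H G by fact
  have eq: "derived_set G H = (\<lambda>(x, y). x \<otimes> y \<otimes> inv x \<otimes> inv y) ` (H \<times> H)" by auto
  show ?thesis unfolding derived_def
  proof (rule connectedin_generate)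
    show "connectedin T (derived_set G H)" unfolding eq
      using H by (intro connectedin_continuous_map_image[OF continuous_map_commutator])
        (simp add: connectedin_Times)
    have "\<one> \<otimes> \<one> \<otimes> inv \<one> \<otimes> inv \<one> \<in> derived_set G H" using H.one_closed by blast
    then show "\<one> \<in> derived_set G H" by simp
    show "inv x \<in> derived_set G H" if "x \<in> derived_set G H" for x
    proof -
      from that obtain a b where ab: "a \<in> H" "b \<in> H" "x = a \<otimes> b \<otimes> inv a \<otimes> inv b" by blast
      then have "inv x = b \<otimes> a \<otimes> inv b \<otimes> inv a"
        using H.mem_carrier by (simp add: inv_mult_group m_assoc)
      then show ?thesis using ab(1,2) by blast
    qed
  qed
qed

end

section \<open>Unique continuation for functions of finite rank\<close>

text \<open>Factorised form of the condition that all translates of f lie in one finite-dimensional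
  space; matrix coefficients of representations are the model. In this form sums and products of
  functions become disjoint unions and products of index sets.\<close>

definition finite_rank :: "('a, 'm) monoid_scheme \<Rightarrow> ('a \<Rightarrow> real) \<Rightarrow> bool"
  where "finite_rank G f \<longleftrightarrow> (\<exists>(n::nat) a c. \<forall>x\<in>carrier G. \<forall>y\<in>carrier G.
    f (x \<otimes>\<^bsub>G\<^esub> y) = (\<Sum>i<n. a i x * c i y))"

lemma finite_rankI:
  assumes I: "finite I"
    and f: "\<And>x y. x \<in> carrier G \<Longrightarrow> y \<in> carrier G \<Longrightarrow> f (x \<otimes>\<^bsub>G\<^esub> y) = (\<Sum>i\<in>I. a i x * c i y)"
  shows "finite_rank G f"
proof -
  obtain h where h: "bij_betw h {..<card I} I"
    using ex_bij_betw_nat_finite[OF I] by (auto simp: atLeast0LessThan)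
  have "f (x \<otimes>\<^bsub>G\<^esub> y) = (\<Sum>i<card I. a (h i) x * c (h i) y)"
    if "x \<in> carrier G" "y \<in> carrier G" for x y
    using f[OF that] sum.reindex_bij_betw[OF h, of "\<lambda>i. a i x * c i y"] by simp
  then show ?thesis unfolding finite_rank_def
    by (intro exI[of _ "card I"] exI[of _ "\<lambda>i. a (h i)"] exI[of _ "\<lambda>i. c (h i)"]) auto
qed

lemma finite_rank_const: "finite_rank G (\<lambda>x. r)"
  by (rule finite_rankI[of "{()}" _ _ "\<lambda>_ _. r" "\<lambda>_ _. 1"]) auto

lemma finite_rank_add:
  assumes "finite_rank G f" "finite_rank G g"
  shows "finite_rank G (\<lambda>x. f x + g x)"
proof -
  obtain n a c where f: "\<forall>x\<in>carrier G. \<forall>y\<in>carrier G. f (x \<otimes>\<^bsub>G\<^esub> y) = (\<Sum>i<(n::nat). a i x * c i y)"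
    using assms(1) unfolding finite_rank_def by blast
  obtain m a' c' where g: "\<forall>x\<in>carrier G. \<forall>y\<in>carrier G. g (x \<otimes>\<^bsub>G\<^esub> y) = (\<Sum>i<(m::nat). a' i x * c' i y)"
    using assms(2) unfolding finite_rank_def by blast
  show ?thesis
    using f g
    by (intro finite_rankI[of "{..<n} <+> {..<m}" _ _ "case_sum a a'" "case_sum c c'"])
      (auto simp: sum.Plus)
qed

lemma finite_rank_mult:
  assumes "finite_rank G f" "finite_rank G g"
  shows "finite_rank G (\<lambda>x. f x * g x)"
proof -
  obtain n a c where f: "\<forall>x\<in>carrier G. \<forall>y\<in>carrier G. f (x \<otimes>\<^bsub>G\<^esub> y) = (\<Sum>i<(n::nat). a i x * c i y)"
    using assms(1) unfolding finite_rank_def by blast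
  obtain m a' c' where g: "\<forall>x\<in>carrier G. \<forall>y\<in>carrier G. g (x \<otimes>\<^bsub>G\<^esub> y) = (\<Sum>i<(m::nat). a' i x * c' i y)"
    using assms(2) unfolding finite_rank_def by blast
  show ?thesis
  proof (rule finite_rankI)
    fix x y assume "x \<in> carrier G" "y \<in> carrier G"
    then have "f (x \<otimes>\<^bsub>G\<^esub> y) * g (x \<otimes>\<^bsub>G\<^esub> y) = (\<Sum>i<n. a i x * c i y) * (\<Sum>j<m. a' j x * c' j y)"
      using f g by simp
    also have "\<dots> = (\<Sum>p\<in>{..<n} \<times> {..<m}. (a (fst p) x * c (fst p) y) * (a' (snd p) x * c' (snd p) y))"
      by (simp only: sum_product sum.cartesian_product case_prod_unfold)
    also have "\<dots> = (\<Sum>p\<in>{..<n} \<times> {..<m}. (a (fst p) x * a' (snd p) x) * (c (fst p) y * c' (snd p) y))"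
      by (simp only: mult_ac)
    finally show "f (x \<otimes>\<^bsub>G\<^esub> y) * g (x \<otimes>\<^bsub>G\<^esub> y) =
      (\<Sum>p\<in>{..<n} \<times> {..<m}. (a (fst p) x * a' (snd p) x) * (c (fst p) y * c' (snd p) y))" .
  qed simp
qed

lemma finite_rank_sum:
  assumes "\<And>i. i \<in> I \<Longrightarrow> finite_rank G (f i)"
  shows "finite_rank G (\<lambda>x. \<Sum>i\<in>I. f i x)"
  using assms
  by (induction I rule: infinite_finite_induct) (auto intro: finite_rank_const finite_rank_add)

lemma finite_rank_prod:
  assumes "\<And>i. i \<in> I \<Longrightarrow> finite_rank G (f i)"
  shows "finite_rank G (\<lambda>x. \<Prod>i\<in>I. f i x)"
  using assms
  by (induction I rule: infinite_finite_induct) (auto intro: finite_rank_const finite_rank_mult)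

text \<open>The Leibniz formula makes the determinant a polynomial in the entries.\<close>

lemma finite_rank_det:
  assumes "\<And>i j. i < n \<Longrightarrow> j < n \<Longrightarrow> finite_rank G (\<lambda>x. E x i j)"
  shows "finite_rank G (\<lambda>x. Determinant.det (mat n n (\<lambda>(i, j). E x i j)))"
proof -
  have "Determinant.det (mat n n (\<lambda>(i, j). E x i j)) =
      (\<Sum>p\<in>{p. p permutes {0..<n}}. signof p * (\<Prod>i = 0..<n. E x i (p i)))" for x
    by (subst det_def'[of _ n]) (auto intro!: sum.cong prod.cong simp: permutes_in_image)
  moreover have "finite_rank G (\<lambda>x. \<Sum>p\<in>{p. p permutes {0..<n}}. signof p * (\<Prod>i = 0..<n. E x i (p i)))"
    using assms permutes_in_image
    by (intro finite_rank_sum finite_rank_mult finite_rank_const finite_rank_prod) fastforce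
  ultimately show ?thesis by simp
qed

text \<open>The combinations with vanishing germ at p form a subspace of a finite-dimensional space.
  Finitely many of them span it, and the intersection of their neighbourhoods works for all. The
  induction finds such a spanning set by elimination, with at most one pivot relation per
  index.\<close>

lemma germ_relations_stabilize:
  fixes a :: "nat \<Rightarrow> 'a \<Rightarrow> real"
  assumes p: "p \<in> topspace T"
  shows "\<exists>W. openin T W \<and> p \<in> W \<and>
    (\<forall>c. (\<exists>W'. openin T W' \<and> p \<in> W' \<and> (\<forall>x\<in>W'. (\<Sum>i<n. c i * a i x) = 0)) \<longrightarrow>
      (\<forall>x\<in>W. (\<Sum>i<n. c i * a i x) = 0))"
proof (induction n)
  case 0
  show ?case using p by (intro exI[of _ "topspace T"]) auto
next
  case (Suc n)
  define van where "van c m W \<longleftrightarrow> openin T W \<and> p \<in> W \<and> (\<forall>x\<in>W. (\<Sum>i<m. c i * a i x) = 0)"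
    for c :: "nat \<Rightarrow> real" and m W
  obtain W where W: "openin T W" "p \<in> W"
    and IH: "\<And>c W' x. van c n W' \<Longrightarrow> x \<in> W \<Longrightarrow> (\<Sum>i<n. c i * a i x) = 0"
    using Suc unfolding van_def by blast
  have "\<exists>W0. openin T W0 \<and> p \<in> W0 \<and> (\<forall>c W' x. van c (Suc n) W' \<longrightarrow> x \<in> W0 \<longrightarrow> (\<Sum>i<Suc n. c i * a i x) = 0)"
  proof (cases "\<exists>c W'. van c (Suc n) W' \<and> c n \<noteq> 0")
    case False
    have "(\<Sum>i<Suc n. c i * a i x) = 0" if "van c (Suc n) W'" "x \<in> W" for c W' x
    proof -
      have "c n = 0" using False that by blast
      moreover from this have "van c n W'" using that by (simp add: van_def)
      ultimately show ?thesis using IH[OF _ that(2)] by auto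
    qed
    then show ?thesis using W by blast
  next
    case True
    then obtain c W' where c: "van c (Suc n) W'" "c n \<noteq> 0" by blast
    have "(\<Sum>i<Suc n. d i * a i x) = 0" if d: "van d (Suc n) W''" and x: "x \<in> W \<inter> W'" for d W'' x
    proof -
      \<comment> \<open>Subtracting a multiple of the pivot relation c kills the last coefficient of
        d, so the induction hypothesis applies to e.\<close>
      define e where "e i = d i - d n / c n * c i" for i
      have e: "(\<Sum>i<Suc n. e i * a i y) =
          (\<Sum>i<Suc n. d i * a i y) - d n / c n * (\<Sum>i<Suc n. c i * a i y)" for y
        unfolding e_def sum_distrib_left sum_subtractf[symmetric]
        by (intro sum.cong) (auto simp: algebra_simps)
      have e': "(\<Sum>i<Suc n. e i * a i y) = (\<Sum>i<n. e i * a i y)" for y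
        using c(2) by (simp add: e_def)
      have "van e n (W' \<inter> W'')"
        unfolding van_def
      proof (intro conjI ballI)
        show "(\<Sum>i<n. e i * a i y) = 0" if "y \<in> W' \<inter> W''" for y
          using that c(1) d e[of y] e'[of y] unfolding van_def by simp
      qed (use c d in \<open>auto simp: van_def\<close>)
      then have "(\<Sum>i<n. e i * a i x) = 0" using IH x by blast
      then show ?thesis using e[of x] e'[of x] c(1) x unfolding van_def by simp
    qed
    moreover have "openin T (W \<inter> W')" "p \<in> W \<inter> W'" using W c by (auto simp: van_def)
    ultimately show ?thesis by blast
  qed
  then obtain W0 where W0: "openin T W0" "p \<in> W0"
    and stab: "\<And>c W' x. van c (Suc n) W' \<Longrightarrow> x \<in> W0 \<Longrightarrow> (\<Sum>i<Suc n. c i * a i x) = 0"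
    by (elim exE conjE) metis
  show ?case
  proof (intro exI[of _ W0] conjI allI impI ballI W0)
    fix c x assume "\<exists>W'. openin T W' \<and> p \<in> W' \<and> (\<forall>x\<in>W'. (\<Sum>i<Suc n. c i * a i x) = 0)" "x \<in> W0"
    then show "(\<Sum>i<Suc n. c i * a i x) = 0" using stab[of c] unfolding van_def by metis
  qed
qed

section \<open>Unique continuation on a connected group\<close>

context continuous_group
begin

text \<open>Takes the place of analyticity: if \<open>f\<close> vanishes near \<open>w\<close>, then the set of \<open>g\<close> such that \<open>f\<close>
  vanishes near \<open>w \<otimes> g\<close> absorbs right multiplication by a fixed neighbourhood of \<open>\<one>\<close>, because
  by finite rank all the functions \<open>x \<mapsto> f (w \<otimes> g \<otimes> x)\<close> with vanishing germ at \<open>\<one>\<close> vanish on a common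
  neighbourhood.\<close>

lemma finite_rank_vanishing:
  assumes conn: "connectedin T (carrier G)"
    and f: "finite_rank G f"
    and W: "openin T W" "W \<noteq> {}" "\<And>x. x \<in> W \<Longrightarrow> f x = 0"
    and z: "z \<in> carrier G"
  shows "f z = 0"
proof -
  obtain n a c where fac: "\<And>x y. x \<in> carrier G \<Longrightarrow> y \<in> carrier G \<Longrightarrow>
      f (x \<otimes> y) = (\<Sum>i<(n::nat). a i x * c i y)"
    using f unfolding finite_rank_def by metis
  have "\<exists>U. openin T U \<and> \<one> \<in> U \<and>
    (\<forall>a. (\<exists>W'. openin T W' \<and> \<one> \<in> W' \<and> (\<forall>x\<in>W'. (\<Sum>i<n. a i * c i x) = 0)) \<longrightarrow>
      (\<forall>x\<in>U. (\<Sum>i<n. a i * c i x) = 0))"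
    by (rule germ_relations_stabilize) simp
  then obtain U where U: "openin T U" "\<one> \<in> U"
    and stab: "\<And>a W' y. openin T W' \<Longrightarrow> \<one> \<in> W' \<Longrightarrow> \<forall>x\<in>W'. (\<Sum>i<n. a i * c i x) = 0 \<Longrightarrow>
      y \<in> U \<Longrightarrow> (\<Sum>i<n. a i * c i y) = 0"
    by blast
  have sub: "V \<subseteq> carrier G" if "openin T V" for V using openin_subset[OF that] by simp
  obtain w where w: "w \<in> W" using W by blast
  then have wG: "w \<in> carrier G" using sub W by blast
  define S where "S = {g \<in> carrier G. \<exists>V. openin T V \<and> \<one> \<in> V \<and> (\<forall>x\<in>V. f (w \<otimes> g \<otimes> x) = 0)}"
  have vanU: "f (w \<otimes> g \<otimes> y) = 0" if "g \<in> S" "y \<in> U" for g y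
  proof -
    from that obtain V where V: "openin T V" "\<one> \<in> V" "\<forall>x\<in>V. f (w \<otimes> g \<otimes> x) = 0" and g: "g \<in> carrier G"
      unfolding S_def by blast
    have "\<forall>x\<in>V. (\<Sum>i<n. a i (w \<otimes> g) * c i x) = 0"
    proof
      fix x assume x: "x \<in> V"
      then have "x \<in> carrier G" using sub[OF V(1)] by blast
      then show "(\<Sum>i<n. a i (w \<otimes> g) * c i x) = 0"
        using V(3) x fac[of "w \<otimes> g" x] wG g by simp
    qed
    from stab[OF V(1,2) this that(2)] show ?thesis
      using fac[of "w \<otimes> g" y] sub[OF U(1)] that wG g by auto
  qed
  have "S = carrier G"
  proof (rule connected_subgroup_induct[OF subgroup_self conn U])
    show "\<one> \<in> S"
    proof -
      obtain V where "openin T V" "\<one> \<in> V" "\<And>y. y \<in> V \<Longrightarrow> w \<otimes> y \<in> W"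
        by (rule rtrans_neighbourhood[OF W(1) w]) blast
      then show ?thesis using W wG unfolding S_def by auto
    qed
    show "x \<otimes> y \<in> S" if "x \<in> S" "y \<in> carrier G \<inter> U" for x y
    proof -
      have x: "x \<in> carrier G" using that S_def by blast
      have "y \<in> U" using that by blast
      then obtain V where V: "openin T V" "\<one> \<in> V" "\<And>z. z \<in> V \<Longrightarrow> y \<otimes> z \<in> U"
        using rtrans_neighbourhood[OF U(1)] by metis
      have "f (w \<otimes> (x \<otimes> y) \<otimes> z) = 0" if "z \<in> V" for z
        using vanU[OF \<open>x \<in> S\<close> V(3)[OF that]] sub[OF V(1)] that x wG \<open>y \<in> carrier G \<inter> U\<close>
        by (auto simp: m_assoc subset_iff)
      then show ?thesis using V x that unfolding S_def by blast
    qed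
  qed (auto simp: S_def)
  then have "inv w \<otimes> z \<in> S" using z wG by simp
  from vanU[OF this U(2)] show ?thesis using z wG by (simp add: m_assoc[symmetric])
qed

end

text \<open>The basis is chosen before \<open>L\<close>, so that for a family \<open>L x\<close> the
  determinant is a single function of x, polynomial in matrix coefficients. An orthonormal basis
  makes the entries inner products. The size n may be 0; then the determinant is 1, matching the
  absence of nonzero vectors.\<close>

lemma det_compression_basis:
  fixes M :: "'e::euclidean_space set"
  assumes "subspace M"
  obtains n and b :: "nat \<Rightarrow> 'e" where
    "\<And>i. i < n \<Longrightarrow> b i \<in> M"
    "\<And>L. linear L \<Longrightarrow> L ` M \<subseteq> M \<Longrightarrow>
      Determinant.det (mat n n (\<lambda>(i, j). b i \<bullet> L (b j))) = 0 \<longleftrightarrow> (\<exists>v\<in>M. v \<noteq> 0 \<and> L v = 0)"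
proof -
  obtain B where B: "B \<subseteq> M" "pairwise real_inner_class.orthogonal B" "\<And>x. x \<in> B \<Longrightarrow> norm x = 1"
      "independent B" "span B = M"
    using orthonormal_basis_subspace[OF assms] by metis
  have fin: "finite B" using B(4) by (rule independent_imp_finite)
  define n where "n = card B"
  obtain b where b: "bij_betw b {0..<n} B"
    using ex_bij_betw_nat_finite[OF fin] n_def by blast
  have bM: "b i \<in> M" if "i < n" for i
    using b B(1) that by (auto simp: bij_betw_def)
  have expand: "(\<Sum>i = 0..<n. (b i \<bullet> u) *\<^sub>R b i) = u" if "u \<in> M" for u
  proof -
    have "(\<Sum>i = 0..<n. (b i \<bullet> u) *\<^sub>R b i) = (\<Sum>x\<in>B. (u \<bullet> x) *\<^sub>R x)"
      using sum.reindex_bij_betw[OF b, of "\<lambda>x. (u \<bullet> x) *\<^sub>R x"] by (simp add: inner_commute)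
    also have "\<dots> = u"
      using that B fin by (intro orthonormal_basis_expand) auto
    finally show ?thesis .
  qed
  have inner_b: "b i \<bullet> b j = (if i = j then 1 else 0)" if "i < n" "j < n" for i j
  proof (cases "i = j")
    case True
    then show ?thesis using B(3)[of "b i"] b that by (auto simp: bij_betw_def norm_eq_1)
  next
    case False
    then have "b i \<noteq> b j" using b that by (auto simp: bij_betw_def inj_on_def)
    moreover have "b i \<in> B" "b j \<in> B" using b that by (auto simp: bij_betw_def)
    ultimately show ?thesis using B(2) False by (auto simp: pairwise_def real_inner_class.orthogonal_def)
  qed
  have "Determinant.det (mat n n (\<lambda>(i, j). b i \<bullet> L (b j))) = 0 \<longleftrightarrow> (\<exists>v\<in>M. v \<noteq> 0 \<and> L v = 0)"
    if L: "linear L" "L ` M \<subseteq> M" for L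
  proof -
    define A where "A = mat n n (\<lambda>(i, j). b i \<bullet> L (b j))"
    define comb where "comb c = (\<Sum>j = 0..<n. vec_index c j *\<^sub>R b j)" for c
    have A: "A \<in> carrier_mat n n" by (simp add: A_def)
    have combM: "comb c \<in> M" for c
      unfolding comb_def using bM by (intro subspace_sum subspace_scale assms) auto
    have coord: "b i \<bullet> comb c = vec_index c i" if "i < n" for c i
      using that by (simp add: comb_def inner_sum_right inner_b if_distrib sum.delta cong: if_cong)
    have mv: "A *\<^sub>v c = vec n (\<lambda>i. b i \<bullet> L (comb c))" if "c \<in> carrier_vec n" for c
    proof
      show "vec_index (A *\<^sub>v c) i = vec_index (vec n (\<lambda>i. b i \<bullet> L (comb c))) i"
        if "i < dim_vec (vec n (\<lambda>i. b i \<bullet> L (comb c)))" for i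
        using that \<open>c \<in> carrier_vec n\<close>
        by (auto simp: A_def comb_def scalar_prod_def linear_sum[OF L(1)] linear_scale[OF L(1)]
            inner_sum_right mult.commute intro!: sum.cong)
    qed (simp add: A_def)
    have "Determinant.det A = 0 \<longleftrightarrow> (\<exists>c. c \<in> carrier_vec n \<and> c \<noteq> 0\<^sub>v n \<and> A *\<^sub>v c = 0\<^sub>v n)"
      by (rule det_0_iff_vec_prod_zero[OF A])
    also have "\<dots> \<longleftrightarrow> (\<exists>v\<in>M. v \<noteq> 0 \<and> L v = 0)"
    proof
      assume "\<exists>c. c \<in> carrier_vec n \<and> c \<noteq> 0\<^sub>v n \<and> A *\<^sub>v c = 0\<^sub>v n"
      then obtain c where c: "c \<in> carrier_vec n" "c \<noteq> 0\<^sub>v n" "A *\<^sub>v c = 0\<^sub>v n" by blast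
      have "b i \<bullet> L (comb c) = 0" if "i < n" for i
        using c(3) that unfolding mv[OF c(1)] by (metis index_vec index_zero_vec(1))
      then have "L (comb c) = 0"
        using expand[of "L (comb c)"] L(2) combM by (metis (no_types, lifting) atLeastLessThan_iff
            image_subset_iff scaleR_zero_left sum.neutral)
      moreover have "comb c \<noteq> 0"
      proof
        assume "comb c = 0"
        then have "c = 0\<^sub>v n" using coord[of _ c] c(1) by (intro eq_vecI) auto
        with c(2) show False ..
      qed
      ultimately show "\<exists>v\<in>M. v \<noteq> 0 \<and> L v = 0" using combM by blast
    next
      assume "\<exists>v\<in>M. v \<noteq> 0 \<and> L v = 0"
      then obtain v where v: "v \<in> M" "v \<noteq> 0" "L v = 0" by blast
      define c where "c = vec n (\<lambda>i. b i \<bullet> v)"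
      have cv: "comb c = v" using expand[OF v(1)] by (simp add: comb_def c_def)
      have c: "c \<in> carrier_vec n" by (simp add: c_def)
      have "A *\<^sub>v c = 0\<^sub>v n" unfolding mv[OF c] cv v(3) by auto
      moreover have "c \<noteq> 0\<^sub>v n" using cv v(2) by (auto simp: comb_def)
      ultimately show "\<exists>c. c \<in> carrier_vec n \<and> c \<noteq> 0\<^sub>v n \<and> A *\<^sub>v c = 0\<^sub>v n" using c by blast
    qed
    finally show ?thesis unfolding A_def .
  qed
  then show thesis using that bM by blast
qed

section \<open>Nonsingularity at generic points\<close>

context continuous_group
begin

lemma generic_nonsingular:
  fixes L :: "'a \<Rightarrow> 'e \<Rightarrow> 'e::euclidean_space"
  assumes conn: "connectedin T (carrier G)" and V: "subspace V"
    and L: "\<And>x. x \<in> carrier G \<Longrightarrow> linear (L x)" "\<And>x. x \<in> carrier G \<Longrightarrow> L x ` V \<subseteq> V"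
    and rank: "\<And>u v. u \<in> V \<Longrightarrow> v \<in> V \<Longrightarrow> finite_rank G (\<lambda>x. u \<bullet> L x v)"
    and one: "\<And>v. v \<in> V \<Longrightarrow> L \<one> v = 0 \<Longrightarrow> v = 0"
    and W: "openin T W" "W \<noteq> {}"
  obtains x where "x \<in> W" "\<And>v. v \<in> V \<Longrightarrow> L x v = 0 \<Longrightarrow> v = 0"
proof -
  obtain n and b :: "nat \<Rightarrow> 'e" where bV: "\<And>i. i < n \<Longrightarrow> b i \<in> V"
    and b: "\<And>L. linear L \<Longrightarrow> L ` V \<subseteq> V \<Longrightarrow>
      Determinant.det (mat n n (\<lambda>(i, j). b i \<bullet> L (b j))) = 0 \<longleftrightarrow> (\<exists>v\<in>V. v \<noteq> 0 \<and> L v = 0)"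
    by (rule det_compression_basis[OF V]) blast
  define f where "f x = Determinant.det (mat n n (\<lambda>(i, j). b i \<bullet> L x (b j)))" for x
  have "finite_rank G f" unfolding f_def
    by (intro finite_rank_det rank bV)
  moreover have "f \<one> \<noteq> 0"
    unfolding f_def using b[of "L \<one>"] L[of \<one>] one by blast
  ultimately obtain x where x: "x \<in> W" "f x \<noteq> 0"
    using finite_rank_vanishing[OF conn _ W, of f] one_closed by blast
  moreover have "x \<in> carrier G" using x openin_subset[OF W(1)] by auto
  ultimately show thesis using that[of x] b[of "L x"] L[of x] unfolding f_def by blast
qed

end

section \<open>Tangent spaces of subgroups\<close>

text \<open>This is o(O(t)) = o(t): convergence of b(t) / t makes b of order t.\<close>

lemma negligible_over_ident:
  fixes a :: "real \<Rightarrow> 'e::real_normed_vector" and b :: "real \<Rightarrow> 'f::real_normed_vector"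
  assumes small: "\<And>\<epsilon>. \<epsilon> > 0 \<Longrightarrow> \<forall>\<^sub>F t in at_right 0. norm (a t) \<le> \<epsilon> * norm (b t)"
    and b: "((\<lambda>t. b t /\<^sub>R t) \<longlongrightarrow> v) (at_right 0)"
  shows "((\<lambda>t. a t /\<^sub>R t) \<longlongrightarrow> 0) (at_right 0)"
proof (rule tendstoI)
  fix e :: real assume e: "e > 0"
  \<comment> \<open>Strictly above norm v, so that it eventually bounds b(t) / t, and positive even
    when v = 0.\<close>
  define C where "C = norm v + 1"
  have C: "C > 0" by (simp add: C_def add_nonneg_pos)
  have "\<forall>\<^sub>F t in at_right 0. norm (b t /\<^sub>R t) < C"
    using tendsto_norm[OF b] by (rule order_tendstoD) (simp add: C_def)
  moreover have "\<forall>\<^sub>F t in at_right 0. norm (a t) \<le> e / (2 * C) * norm (b t)"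
    using e C by (intro small) simp
  ultimately show "\<forall>\<^sub>F t in at_right 0. dist (a t /\<^sub>R t) 0 < e"
    using eventually_at_right_less
  proof eventually_elim
    case (elim t)
    have n: "norm (c /\<^sub>R t) = norm c / t" for c :: "'c::real_normed_vector"
      using elim(3) by (simp add: divide_inverse_commute)
    have "norm (a t /\<^sub>R t) \<le> (e / (2 * C) * norm (b t)) / t"
      unfolding n using elim(2,3) by (intro divide_right_mono) auto
    also have "\<dots> = e / (2 * C) * norm (b t /\<^sub>R t)"
      unfolding n by (simp only: times_divide_eq_right)
    also have "\<dots> \<le> e / (2 * C) * C"
      using elim(1) e C by (intro mult_left_mono) auto
    also have "\<dots> < e" using e C by simp
    finally show ?case by simp
  qed
qed

text \<open>The error of \<open>\<phi> (x \<otimes> y) \<approx> \<phi> x + \<phi> y\<close> is bounded in terms of \<open>\<phi> y\<close> alone, so that errors add up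
  linearly along powers.\<close>

locale chart_at_identity = continuous_group +
  fixes U :: "'a set" and \<phi> :: "'a \<Rightarrow> 'e::euclidean_space"
  assumes openin_U: "openin T U" and one_in_U: "\<one> \<in> U" and \<phi>_one: "\<phi> \<one> = 0"
    and small_imp_in_neighbourhood: "\<And>W. openin T W \<Longrightarrow> \<one> \<in> W \<Longrightarrow>
      \<exists>\<delta>>0. \<forall>y\<in>U. norm (\<phi> y) < \<delta> \<longrightarrow> y \<in> W"
    and neighbourhood_small: "\<And>\<delta>. \<delta> > 0 \<Longrightarrow>
      \<exists>W. openin T W \<and> \<one> \<in> W \<and> W \<subseteq> U \<and> (\<forall>y\<in>W. norm (\<phi> y) < \<delta>)"
    and mult_approx: "\<And>\<epsilon>. \<epsilon> > 0 \<Longrightarrow>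
      \<exists>\<delta>>0. \<forall>x\<in>U. \<forall>y\<in>U. norm (\<phi> x) < \<delta> \<longrightarrow> norm (\<phi> y) < \<delta> \<longrightarrow>
        x \<otimes> y \<in> U \<and> norm (\<phi> (x \<otimes> y) - \<phi> x - \<phi> y) \<le> \<epsilon> * norm (\<phi> y)"
    and conj_differentiable: "\<exists>W. openin T W \<and> \<one> \<in> W \<and> (\<forall>x\<in>W. \<exists>D f.
      (f has_derivative D) (at 0) \<and> f 0 = 0 \<and>
      (\<exists>\<delta>>0. \<forall>y\<in>U. norm (\<phi> y) < \<delta> \<longrightarrow>
        x \<otimes> y \<otimes> inv x \<in> U \<and> \<phi> (x \<otimes> y \<otimes> inv x) = f (\<phi> y)))"
begin

lemma U_subset: "U \<subseteq> carrier G"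
  using openin_subset[OF openin_U] by simp

text \<open>Apply \<open>mult_approx\<close> to x and z = x^-1 y. Its error is relative to \<phi> z,
  which is absorbed because \<phi> z is comparable to the difference \<phi> y - \<phi> x. An error
  relative to this difference is what matters when x and y are much closer to each other than to
  \<one>.\<close>

lemma quotient_approx:
  assumes "\<epsilon> > 0"
  obtains \<delta> where "\<delta> > 0" "\<And>x y. x \<in> U \<Longrightarrow> y \<in> U \<Longrightarrow> norm (\<phi> x) < \<delta> \<Longrightarrow> norm (\<phi> y) < \<delta> \<Longrightarrow>
    inv x \<otimes> y \<in> U \<and> norm (\<phi> (inv x \<otimes> y) - (\<phi> y - \<phi> x)) \<le> \<epsilon> * norm (\<phi> y - \<phi> x)"
proof -
  \<comment> \<open>At most 1/2 so that the error can be absorbed at the cost of a factor 2, and at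
    most \<epsilon>/2 to pay for that factor.\<close>
  define e where "e = min (1/2) (\<epsilon>/2)"
  have e: "e > 0" "e \<le> 1/2" "2 * e \<le> \<epsilon>" using assms by (auto simp: e_def)
  obtain d1 where d1: "d1 > 0" and approx: "\<And>x y. x \<in> U \<Longrightarrow> y \<in> U \<Longrightarrow> norm (\<phi> x) < d1 \<Longrightarrow>
      norm (\<phi> y) < d1 \<Longrightarrow> norm (\<phi> (x \<otimes> y) - \<phi> x - \<phi> y) \<le> e * norm (\<phi> y)"
    using mult_approx[OF e(1)] by metis
  obtain W1 where W1: "openin T W1" "\<one> \<in> W1" "W1 \<subseteq> U" "\<And>y. y \<in> W1 \<Longrightarrow> norm (\<phi> y) < d1"
    using neighbourhood_small[OF d1] by metis
  obtain W2 where W2: "openin T W2" "\<one> \<in> W2" "\<And>x y. x \<in> W2 \<Longrightarrow> y \<in> W2 \<Longrightarrow> inv x \<otimes> y \<in> W1"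
    using division_neighbourhood[OF W1(1,2)] by metis
  obtain d2 where d2: "d2 > 0" "\<And>y. y \<in> U \<Longrightarrow> norm (\<phi> y) < d2 \<Longrightarrow> y \<in> W2"
    using small_imp_in_neighbourhood[OF W2(1,2)] by metis
  show thesis
  proof (rule that[of "min d1 d2"])
    fix x y assume xy: "x \<in> U" "y \<in> U" "norm (\<phi> x) < min d1 d2" "norm (\<phi> y) < min d1 d2"
    have c: "x \<in> carrier G" "y \<in> carrier G" using xy U_subset by auto
    let ?z = "inv x \<otimes> y"
    have z: "?z \<in> W1" using xy d2 W2(3) by auto
    have "norm (\<phi> (x \<otimes> ?z) - \<phi> x - \<phi> ?z) \<le> e * norm (\<phi> ?z)"
      using approx[of x ?z] xy z W1 by auto
    moreover have "x \<otimes> ?z = y" using c by (simp add: m_assoc[symmetric])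
    ultimately have a: "norm (\<phi> y - \<phi> x - \<phi> ?z) \<le> e * norm (\<phi> ?z)" by simp
    have "e * norm (\<phi> ?z) \<le> 1/2 * norm (\<phi> ?z)"
      using e by (intro mult_right_mono) auto
    moreover have "norm (\<phi> ?z) \<le> norm (\<phi> y - \<phi> x) + norm (\<phi> y - \<phi> x - \<phi> ?z)"
      using norm_triangle_ineq4[of "\<phi> y - \<phi> x" "\<phi> y - \<phi> x - \<phi> ?z"] by simp
    ultimately have "norm (\<phi> ?z) \<le> 2 * norm (\<phi> y - \<phi> x)" using a by linarith
    then have "e * norm (\<phi> ?z) \<le> e * (2 * norm (\<phi> y - \<phi> x))"
      using e by (intro mult_left_mono) auto
    also have "\<dots> \<le> \<epsilon> * norm (\<phi> y - \<phi> x)"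
      using mult_right_mono[OF e(3), of "norm (\<phi> y - \<phi> x)"] by simp
    finally show "?z \<in> U \<and> norm (\<phi> ?z - (\<phi> y - \<phi> x)) \<le> \<epsilon> * norm (\<phi> y - \<phi> x)"
      using a z W1 by (auto simp: norm_minus_commute)
  qed (use d1 d2 in auto)
qed

text \<open>Only a right-sided limit at 0 is asked, with no continuity of \<gamma>. Thus a curve in
  a subgroup may be assembled by choosing an element for each t separately, as in
  \<open>tangent_spaceI\<close>.\<close>

definition tangent :: "(real \<Rightarrow> 'a) \<Rightarrow> 'e \<Rightarrow> bool"
  where "tangent \<gamma> v \<longleftrightarrow>
    (\<forall>\<^sub>F t in at_right 0. \<gamma> t \<in> U) \<and> ((\<lambda>t. \<phi> (\<gamma> t) /\<^sub>R t) \<longlongrightarrow> v) (at_right 0)"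

text \<open>Group laws apply to \<gamma> t only for small t > 0, once it is known to lie in
  \<open>U\<close>; rewriting a curve by them needs this lemma.\<close>

lemma tangent_cong:
  assumes "tangent \<gamma> v" "\<forall>\<^sub>F t in at_right 0. \<gamma> t = \<eta> t"
  shows "tangent \<eta> v"
  unfolding tangent_def
proof
  show "\<forall>\<^sub>F t in at_right 0. \<eta> t \<in> U"
    using assms unfolding tangent_def by (auto elim: eventually_elim2)
  show "((\<lambda>t. \<phi> (\<eta> t) /\<^sub>R t) \<longlongrightarrow> v) (at_right 0)"
  proof -
    have "\<forall>\<^sub>F t in at_right 0. \<phi> (\<gamma> t) /\<^sub>R t = \<phi> (\<eta> t) /\<^sub>R t"
      using assms(2) by eventually_elim simp
    then show ?thesis using assms(1) unfolding tangent_def by (auto intro: Lim_transform_eventually)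
  qed
qed

lemma tangent_unique: "tangent \<gamma> v \<Longrightarrow> tangent \<gamma> w \<Longrightarrow> v = w"
  unfolding tangent_def using tendsto_unique[OF trivial_limit_at_right_real] by blast

lemma tangent_tendsto_zero:
  assumes "tangent \<gamma> v"
  shows "((\<lambda>t. \<phi> (\<gamma> t)) \<longlongrightarrow> 0) (at_right 0)"
proof -
  have "((\<lambda>t. t *\<^sub>R (\<phi> (\<gamma> t) /\<^sub>R t)) \<longlongrightarrow> 0 *\<^sub>R v) (at_right 0)"
    using assms unfolding tangent_def by (intro tendsto_scaleR tendsto_ident_at) auto
  then have "((\<lambda>t. t *\<^sub>R (\<phi> (\<gamma> t) /\<^sub>R t)) \<longlongrightarrow> 0) (at_right 0)" by simp
  then show ?thesis
    by (rule Lim_transform_eventually) (use eventually_at_right_less[of 0] in \<open>auto elim: eventually_mono\<close>)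
qed

lemma tangent_eventually_small:
  assumes "tangent \<gamma> v" "\<delta> > 0"
  shows "\<forall>\<^sub>F t in at_right 0. \<gamma> t \<in> U \<and> norm (\<phi> (\<gamma> t)) < \<delta>"
  using tendstoD[OF tangent_tendsto_zero[OF assms(1)] assms(2)] conjunct1[OF assms(1)[unfolded tangent_def]]
  by eventually_elim simp

lemma tangent_one: "tangent (\<lambda>t. \<one>) 0"
  by (simp add: tangent_def one_in_U \<phi>_one)

text \<open>The quotient is treated first because it yields the rest: the inverse is a quotient with
  numerator \<one>, and the product is a quotient by an inverse.\<close>

lemma tangent_quotient:
  assumes "tangent \<gamma> v" "tangent \<eta> w"
  shows "tangent (\<lambda>t. inv (\<gamma> t) \<otimes> \<eta> t) (w - v)"
proof -
  have *: "\<forall>\<^sub>F t in at_right 0. inv (\<gamma> t) \<otimes> \<eta> t \<in> U \<and>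
      norm (\<phi> (inv (\<gamma> t) \<otimes> \<eta> t) - (\<phi> (\<eta> t) - \<phi> (\<gamma> t))) \<le> \<epsilon> * norm (\<phi> (\<eta> t) - \<phi> (\<gamma> t))"
    if eps: "\<epsilon> > 0" for \<epsilon>
  proof -
    obtain \<delta> where \<delta>: "\<delta> > 0" "\<And>x y. x \<in> U \<Longrightarrow> y \<in> U \<Longrightarrow> norm (\<phi> x) < \<delta> \<Longrightarrow> norm (\<phi> y) < \<delta> \<Longrightarrow>
      inv x \<otimes> y \<in> U \<and> norm (\<phi> (inv x \<otimes> y) - (\<phi> y - \<phi> x)) \<le> \<epsilon> * norm (\<phi> y - \<phi> x)"
      using quotient_approx[OF eps] by metis
    show ?thesis
      using tangent_eventually_small[OF assms(1) \<delta>(1)] tangent_eventually_small[OF assms(2) \<delta>(1)]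
      by eventually_elim (use \<delta>(2) in blast)
  qed
  have diff: "((\<lambda>t. (\<phi> (\<eta> t) - \<phi> (\<gamma> t)) /\<^sub>R t) \<longlongrightarrow> w - v) (at_right 0)"
    using assms unfolding tangent_def scaleR_diff_right by (intro tendsto_diff) auto
  have "((\<lambda>t. (\<phi> (inv (\<gamma> t) \<otimes> \<eta> t) - (\<phi> (\<eta> t) - \<phi> (\<gamma> t))) /\<^sub>R t) \<longlongrightarrow> 0) (at_right 0)"
  proof (rule negligible_over_ident[OF _ diff])
    show "\<forall>\<^sub>F t in at_right 0. norm (\<phi> (inv (\<gamma> t) \<otimes> \<eta> t) - (\<phi> (\<eta> t) - \<phi> (\<gamma> t))) \<le>
        \<epsilon> * norm (\<phi> (\<eta> t) - \<phi> (\<gamma> t))" if "\<epsilon> > 0" for \<epsilon>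
      using *[OF that] by eventually_elim simp
  qed
  from tendsto_add[OF this diff]
  have "((\<lambda>t. \<phi> (inv (\<gamma> t) \<otimes> \<eta> t) /\<^sub>R t) \<longlongrightarrow> w - v) (at_right 0)"
    by (simp add: scaleR_add_right[symmetric])
  moreover have "\<forall>\<^sub>F t in at_right 0. inv (\<gamma> t) \<otimes> \<eta> t \<in> U"
    using *[of 1] by (auto elim: eventually_mono)
  ultimately show ?thesis unfolding tangent_def by blast
qed

lemma tangent_inv:
  assumes "tangent \<gamma> v"
  shows "tangent (\<lambda>t. inv (\<gamma> t)) (- v)"
proof -
  have "tangent (\<lambda>t. inv (\<gamma> t) \<otimes> \<one>) (- v)"
    using tangent_quotient[OF assms tangent_one] by simp
  moreover have "\<forall>\<^sub>F t in at_right 0. inv (\<gamma> t) \<otimes> \<one> = inv (\<gamma> t)"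
    using assms U_subset unfolding tangent_def by (auto elim!: eventually_mono)
  ultimately show ?thesis by (rule tangent_cong)
qed

lemma tangent_mult:
  assumes "tangent \<gamma> v" "tangent \<eta> w"
  shows "tangent (\<lambda>t. \<gamma> t \<otimes> \<eta> t) (v + w)"
proof -
  have "tangent (\<lambda>t. inv (inv (\<gamma> t)) \<otimes> \<eta> t) (v + w)"
    using tangent_quotient[OF tangent_inv[OF assms(1)] assms(2)] by (simp add: add.commute)
  moreover have "\<forall>\<^sub>F t in at_right 0. inv (inv (\<gamma> t)) \<otimes> \<eta> t = \<gamma> t \<otimes> \<eta> t"
    using assms(1) U_subset unfolding tangent_def by (auto elim!: eventually_mono)
  ultimately show ?thesis by (rule tangent_cong)
qed

lemma tangent_rescale:
  assumes "tangent \<gamma> v" "c > 0"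
  shows "tangent (\<lambda>t. \<gamma> (c * t)) (c *\<^sub>R v)"
proof -
  have lim: "filterlim (\<lambda>t. c * t) (at_right 0) (at_right (0::real))"
    using assms(2) by real_asymp
  have "((\<lambda>t. \<phi> (\<gamma> (c * t)) /\<^sub>R (c * t)) \<longlongrightarrow> v) (at_right 0)"
    using filterlim_compose[OF conjunct2[OF assms(1)[unfolded tangent_def]] lim] .
  then have "((\<lambda>t. c *\<^sub>R (\<phi> (\<gamma> (c * t)) /\<^sub>R (c * t))) \<longlongrightarrow> c *\<^sub>R v) (at_right 0)"
    by (intro tendsto_intros)
  moreover have "c *\<^sub>R (\<phi> (\<gamma> (c * t)) /\<^sub>R (c * t)) = \<phi> (\<gamma> (c * t)) /\<^sub>R t" for t
    using assms(2) by simp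
  moreover have "\<forall>\<^sub>F t in at_right 0. \<gamma> (c * t) \<in> U"
    using assms(1) lim unfolding tangent_def filterlim_iff by blast
  ultimately show ?thesis by (simp only: tangent_def)
qed

section \<open>Tangent vectors to a subgroup\<close>

definition tangent_space :: "'a set \<Rightarrow> 'e set"
  where "tangent_space H = {v. \<exists>\<gamma>. (\<forall>t. \<gamma> t \<in> H) \<and> tangent \<gamma> v}"

lemma tangent_space_mono: "H \<subseteq> K \<Longrightarrow> tangent_space H \<subseteq> tangent_space K"
  unfolding tangent_space_def by blast

lemma subspace_tangent_space:
  assumes "subgroup H G"
  shows "subspace (tangent_space H)"
proof -
  interpret H: subgroup H G by fact
  have zero: "0 \<in> tangent_space H"
    unfolding tangent_space_def using tangent_one by (auto intro!: exI[of _ "\<lambda>t. \<one>"])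
  have add: "v + w \<in> tangent_space H" if "v \<in> tangent_space H" "w \<in> tangent_space H" for v w
  proof -
    from that obtain \<gamma> \<eta> where "\<forall>t. \<gamma> t \<in> H" "tangent \<gamma> v" "\<forall>t. \<eta> t \<in> H" "tangent \<eta> w"
      unfolding tangent_space_def by blast
    then show ?thesis
      unfolding tangent_space_def by (auto intro!: exI[of _ "\<lambda>t. \<gamma> t \<otimes> \<eta> t"] tangent_mult)
  qed
  \<comment> \<open>Negative scalars come from inversion: reparametrising by c t respects the
    right-sided limit only for c > 0.\<close>
  have minus: "- v \<in> tangent_space H" if "v \<in> tangent_space H" for v
  proof -
    from that obtain \<gamma> where "\<forall>t. \<gamma> t \<in> H" "tangent \<gamma> v"
      unfolding tangent_space_def by blast
    then show ?thesis
      unfolding tangent_space_def by (auto intro!: exI[of _ "\<lambda>t. inv (\<gamma> t)"] tangent_inv)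
  qed
  have pos: "c *\<^sub>R v \<in> tangent_space H" if "v \<in> tangent_space H" "c > 0" for v c
  proof -
    from that obtain \<gamma> where "\<forall>t. \<gamma> t \<in> H" "tangent \<gamma> v"
      unfolding tangent_space_def by blast
    then show ?thesis
      unfolding tangent_space_def using \<open>c > 0\<close>
      by (auto intro!: exI[of _ "\<lambda>t. \<gamma> (c * t)"] tangent_rescale)
  qed
  have "c *\<^sub>R v \<in> tangent_space H" if v: "v \<in> tangent_space H" for v c
  proof (cases c "0 :: real" rule: linorder_cases)
    case less
    then show ?thesis using minus[OF pos[OF v, of "- c"]] by simp
  qed (use zero pos v in auto)
  then show ?thesis using zero add by (auto simp: subspace_def)
qed

text \<open>Each multiplication by h costs an error relative to \<phi> h alone, so n of them cost n
  times as much. The 2 in the hypothesis covers main term plus error: as \<epsilon> is at most 1,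
  the intermediate powers have norm at most 2 n norm (\<phi> h) and stay within reach of
  \<open>mult_approx\<close>.\<close>

lemma nat_pow_approx:
  assumes "\<epsilon> > 0" "\<epsilon> \<le> 1"
  obtains \<delta> where "\<delta> > 0" "\<And>h n. h \<in> U \<Longrightarrow> 2 * real n * norm (\<phi> h) < \<delta> \<Longrightarrow>
    h [^] n \<in> U \<and> norm (\<phi> (h [^] n) - real n *\<^sub>R \<phi> h) \<le> \<epsilon> * (real n * norm (\<phi> h))"
proof -
  obtain \<delta> where \<delta>: "\<delta> > 0" and approx: "\<And>x y. x \<in> U \<Longrightarrow> y \<in> U \<Longrightarrow> norm (\<phi> x) < \<delta> \<Longrightarrow>
      norm (\<phi> y) < \<delta> \<Longrightarrow> x \<otimes> y \<in> U \<and> norm (\<phi> (x \<otimes> y) - \<phi> x - \<phi> y) \<le> \<epsilon> * norm (\<phi> y)"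
    using mult_approx[OF assms(1)] by metis
  have "h [^] n \<in> U \<and> norm (\<phi> (h [^] n) - real n *\<^sub>R \<phi> h) \<le> \<epsilon> * (real n * norm (\<phi> h))"
    if "h \<in> U" "2 * real n * norm (\<phi> h) < \<delta>" for h n
    using that(2)
  proof (induction n)
    case 0
    show ?case using one_in_U \<phi>_one by simp
  next
    case (Suc n)
    have "2 * real n * norm (\<phi> h) + 2 * norm (\<phi> h) < \<delta>"
      using Suc.prems by (simp add: algebra_simps)
    then have small: "2 * real n * norm (\<phi> h) < \<delta>" "norm (\<phi> h) < \<delta>"
      using norm_ge_zero[of "\<phi> h"] mult_nonneg_nonneg[of "2 * real n" "norm (\<phi> h)"] by linarith+
    note IH = Suc.IH[OF small(1)]
    have "norm (\<phi> (h [^] n)) \<le> norm (\<phi> (h [^] n) - real n *\<^sub>R \<phi> h) + norm (real n *\<^sub>R \<phi> h)"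
      using norm_triangle_ineq[of "\<phi> (h [^] n) - real n *\<^sub>R \<phi> h" "real n *\<^sub>R \<phi> h"] by simp
    also have "\<dots> \<le> 1 * (real n * norm (\<phi> h)) + real n * norm (\<phi> h)"
      using IH mult_right_mono[OF assms(2), of "real n * norm (\<phi> h)"] by auto
    finally have "norm (\<phi> (h [^] n)) < \<delta>" using small by simp
    from approx[OF _ that(1) this small(2)] IH
    have *: "h [^] n \<otimes> h \<in> U" "norm (\<phi> (h [^] n \<otimes> h) - \<phi> (h [^] n) - \<phi> h) \<le> \<epsilon> * norm (\<phi> h)"
      by auto
    have "norm (\<phi> (h [^] n \<otimes> h) - real (Suc n) *\<^sub>R \<phi> h) \<le>
        norm (\<phi> (h [^] n \<otimes> h) - \<phi> (h [^] n) - \<phi> h) + norm (\<phi> (h [^] n) - real n *\<^sub>R \<phi> h)"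
      using norm_triangle_ineq[of "\<phi> (h [^] n \<otimes> h) - \<phi> (h [^] n) - \<phi> h" "\<phi> (h [^] n) - real n *\<^sub>R \<phi> h"]
      by (simp add: algebra_simps)
    also have "\<dots> \<le> \<epsilon> * (real (Suc n) * norm (\<phi> h))"
      using * IH by (simp add: algebra_simps)
    finally show ?case using * by simp
  qed
  then show thesis using that \<delta> by blast
qed

text \<open>The elements supplied may depend on \<epsilon>, while one curve must serve every
  \<epsilon>. So \<gamma> t is a near minimiser of the distance to v; the slack t allows for an
  infimum that is not attained and vanishes in the limit. For t at most 0 any element of
  \<open>H \<inter> U\<close> will do.\<close>

lemma tangent_spaceI:
  assumes "\<one> \<in> H"
    and approx: "\<And>\<epsilon>. \<epsilon> > 0 \<Longrightarrow> \<forall>\<^sub>F t in at_right 0. \<exists>h\<in>H \<inter> U. dist (\<phi> h /\<^sub>R t) v < \<epsilon>"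
  shows "v \<in> tangent_space H"
proof -
  define D where "D t = (\<lambda>h. \<phi> h /\<^sub>R t) ` (H \<inter> U)" for t
  have ne: "D t \<noteq> {}" for t using assms(1) one_in_U by (auto simp: D_def)
  have "\<exists>h\<in>H \<inter> U. t > 0 \<longrightarrow> dist (\<phi> h /\<^sub>R t) v < infdist v (D t) + t" for t
  proof (cases "t > 0")
    case True
    have "(INF y\<in>D t. dist v y) < infdist v (D t) + t"
      using True by (simp add: infdist_notempty[OF ne])
    then have "\<exists>y\<in>D t. dist v y < infdist v (D t) + t"
      by (subst (asm) cINF_less_iff[OF ne]) auto
    then show ?thesis by (auto simp: D_def dist_commute)
  qed (use assms(1) one_in_U in auto)
  then obtain \<gamma> where \<gamma>: "\<And>t. \<gamma> t \<in> H \<inter> U"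
    and dist: "\<And>t. t > 0 \<Longrightarrow> dist (\<phi> (\<gamma> t) /\<^sub>R t) v < infdist v (D t) + t"
    by metis
  have "((\<lambda>t. \<phi> (\<gamma> t) /\<^sub>R t) \<longlongrightarrow> v) (at_right 0)"
  proof (rule tendstoI)
    fix e :: real assume e: "e > 0"
    have "\<forall>\<^sub>F t in at_right 0. \<exists>h\<in>H \<inter> U. dist (\<phi> h /\<^sub>R t) v < e / 2"
      using e by (intro approx) simp
    moreover have "\<forall>\<^sub>F t in at_right 0. t < e / 2"
      unfolding eventually_at_right_field using e by (intro exI[of _ "e / 2"]) auto
    ultimately show "\<forall>\<^sub>F t in at_right 0. dist (\<phi> (\<gamma> t) /\<^sub>R t) v < e"
      using eventually_at_right_less
    proof eventually_elim
      case (elim t)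
      then obtain h where h: "h \<in> H \<inter> U" "dist (\<phi> h /\<^sub>R t) v < e / 2" by blast
      have "infdist v (D t) \<le> dist v (\<phi> h /\<^sub>R t)"
        using h(1) by (intro infdist_le) (auto simp: D_def)
      then show ?case using dist[OF elim(3)] h(2) elim(2) by (simp add: dist_commute)
    qed
  qed
  then show ?thesis using \<gamma> unfolding tangent_space_def tangent_def
    by (auto intro!: exI[of _ \<gamma>])
qed

text \<open>For small \<open>t\<close>, the power of \<open>h n\<close> with exponent \<open>\<lfloor>t / norm (\<phi> (h n))\<rfloor>\<close> approximates \<open>t v\<close>.\<close>

lemma sequential_direction_in_tangent_space:
  assumes H: "subgroup H G"
    and h: "\<And>n. h n \<in> H \<inter> U" "\<And>n. \<phi> (h n) \<noteq> 0" "(\<lambda>n::nat. \<phi> (h n)) \<longlonglongrightarrow> 0"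
    and dir: "(\<lambda>n. sgn (\<phi> (h n))) \<longlonglongrightarrow> v"
  shows "v \<in> tangent_space H"
proof (rule tangent_spaceI)
  interpret H: subgroup H G by fact
  show "\<one> \<in> H" by simp
  fix \<epsilon> :: real assume "\<epsilon> > 0"
  \<comment> \<open>The bound 1 is for \<open>nat_pow_approx\<close>; the bound \<epsilon>/4 leaves
    room for three errors of size e t.\<close>
  define e where "e = min 1 (\<epsilon> / 4)"
  have e: "e > 0" "e \<le> 1" "3 * e < \<epsilon>" using \<open>\<epsilon> > 0\<close> by (auto simp: e_def)
  obtain \<delta> where \<delta>: "\<delta> > 0" and pow: "\<And>h n. h \<in> U \<Longrightarrow> 2 * real n * norm (\<phi> h) < \<delta> \<Longrightarrow>
    h [^] n \<in> U \<and> norm (\<phi> (h [^] n) - real n *\<^sub>R \<phi> h) \<le> e * (real n * norm (\<phi> h))"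
    using nat_pow_approx[OF e(1,2)] by metis
  have v: "norm v = 1"
  proof -
    have "(\<lambda>n. norm (sgn (\<phi> (h n)))) \<longlonglongrightarrow> norm v" by (intro tendsto_norm dir)
    then have "(\<lambda>n::nat. 1::real) \<longlonglongrightarrow> norm v" using h(2) by (simp add: norm_sgn)
    then show ?thesis by (simp add: LIMSEQ_const_iff)
  qed
  have "\<exists>y\<in>H \<inter> U. dist (\<phi> y /\<^sub>R t) v < \<epsilon>" if t: "t > 0" "2 * t < \<delta>" for t
  proof -
    have "\<forall>\<^sub>F n in sequentially. norm (\<phi> (h n)) < e * t"
      using tendstoD[OF h(3), of "e * t"] e t by simp
    moreover have "\<forall>\<^sub>F n in sequentially. dist (sgn (\<phi> (h n))) v < e"
      using tendstoD[OF dir e(1)] .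
    ultimately have "\<forall>\<^sub>F n in sequentially. norm (\<phi> (h n)) < e * t \<and> dist (sgn (\<phi> (h n))) v < e"
      by eventually_elim auto
    then obtain n where n: "norm (\<phi> (h n)) < e * t" "dist (sgn (\<phi> (h n))) v < e"
      using eventually_happens'[OF sequentially_bot] by blast
    define s where "s = norm (\<phi> (h n))"
    have s: "s > 0" "s < e * t" using h(2)[of n] n by (auto simp: s_def)
    define N where "N = nat \<lfloor>t / s\<rfloor>"
    have N: "real N * s \<le> t" "t < real N * s + s"
    proof -
      have "real N = of_int \<lfloor>t / s\<rfloor>" unfolding N_def using t s by simp
      then have "real N \<le> t / s" "t / s < real N + 1" by linarith+
      then show "real N * s \<le> t" "t < real N * s + s" using s by (auto simp: field_simps)
    qed
    let ?y = "h n [^] N"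
    have "2 * real N * norm (\<phi> (h n)) < \<delta>" using N(1) t by (simp add: s_def[symmetric])
    with pow[of "h n" N] h(1)[of n]
    have y: "?y \<in> U" "norm (\<phi> ?y - real N *\<^sub>R \<phi> (h n)) \<le> e * (real N * s)"
      by (auto simp: s_def)
    have yH: "?y \<in> H"
      using h(1)[of n] by (induction N) auto
    have "real N *\<^sub>R \<phi> (h n) = (real N * s) *\<^sub>R sgn (\<phi> (h n))"
      using s by (simp add: sgn_div_norm s_def)
    \<comment> \<open>Three errors: of the power approximation, of the direction, and of rounding t
      / s down to an integer, which is less than s < e t.\<close>
    then have "\<phi> ?y - t *\<^sub>R v = (\<phi> ?y - real N *\<^sub>R \<phi> (h n)) +
        ((real N * s) *\<^sub>R (sgn (\<phi> (h n)) - v) + (real N * s - t) *\<^sub>R v)"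
      by (simp add: algebra_simps)
    also have "norm \<dots> \<le> e * (real N * s) + ((real N * s) * norm (sgn (\<phi> (h n)) - v) + \<bar>real N * s - t\<bar> * norm v)"
      using s by (intro order.trans[OF norm_triangle_ineq] add_mono y order.trans[OF norm_triangle_ineq]) auto
    also have "\<dots> \<le> e * t + (t * e + e * t)"
    proof (intro add_mono)
      show "e * (real N * s) \<le> e * t" using N e by (intro mult_left_mono) auto
      show "real N * s * norm (sgn (\<phi> (h n)) - v) \<le> t * e"
        using N(1) n(2) t by (intro mult_mono) (auto simp: dist_norm)
      show "\<bar>real N * s - t\<bar> * norm v \<le> e * t" using N s v by simp
    qed
    finally have b: "norm (\<phi> ?y - t *\<^sub>R v) \<le> 3 * e * t" by simp
    have "dist (\<phi> ?y /\<^sub>R t) v = norm (\<phi> ?y - t *\<^sub>R v) / t"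
    proof -
      have "\<phi> ?y /\<^sub>R t - v = (\<phi> ?y - t *\<^sub>R v) /\<^sub>R t" using t by (simp add: algebra_simps)
      then show ?thesis using t by (simp add: dist_norm divide_inverse mult.commute)
    qed
    also have "\<dots> \<le> 3 * e" using b t by (simp add: field_simps)
    finally have "dist (\<phi> ?y /\<^sub>R t) v < \<epsilon>" using e by simp
    then show ?thesis using y yH by blast
  qed
  then show "\<forall>\<^sub>F t in at_right 0. \<exists>h\<in>H \<inter> U. dist (\<phi> h /\<^sub>R t) v < \<epsilon>"
    unfolding eventually_at_right_field using \<delta> by (intro exI[of _ "\<delta> / 2"]) auto
qed

section \<open>Closed subgroups with equal tangent spaces\<close>

text \<open>Since \<open>H\<close> is closed and misses m, the coset H m stays away from \<one>, so
  the infimum of the chart norm over its points in \<open>U\<close> is positive. The infimum need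
  not be attained, but being positive it is strictly below 3/2 of itself, so some point comes within
  that factor.\<close>

lemma closed_subgroup_near_optimal_quotient:
  assumes H: "subgroup H G" "closedin T H" and m: "m \<in> U" "m \<notin> H"
  obtains h where "h \<in> H" "inv h \<otimes> m \<in> U" "\<phi> (inv h \<otimes> m) \<noteq> 0" "norm (\<phi> (inv h \<otimes> m)) \<le> 3/2 * norm (\<phi> m)"
    "\<And>h'. h' \<in> H \<Longrightarrow> inv h' \<otimes> (inv h \<otimes> m) \<in> U \<Longrightarrow>
      norm (\<phi> (inv h \<otimes> m)) \<le> 3/2 * norm (\<phi> (inv h' \<otimes> (inv h \<otimes> m)))"
proof -
  interpret H: subgroup H G by fact
  have mG: "m \<in> carrier G" using m U_subset by blast
  define S where "S = (\<lambda>h. norm (\<phi> (inv h \<otimes> m))) ` {h \<in> H. inv h \<otimes> m \<in> U}"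
  have mS: "norm (\<phi> m) \<in> S" unfolding S_def
    using m mG by (intro image_eqI[of _ _ \<one>]) auto
  have "openin T (carrier G - H)" using H(2) by (metis closedin_def topspace_eq)
  moreover have "m \<in> carrier G - H" using m mG by blast
  ultimately obtain V where V: "openin T V" "\<one> \<in> V" "\<And>y. y \<in> V \<Longrightarrow> m \<otimes> inv y \<in> carrier G - H"
    using rtrans_neighbourhood by metis
  obtain \<delta> where \<delta>: "\<delta> > 0" "\<And>y. y \<in> U \<Longrightarrow> norm (\<phi> y) < \<delta> \<Longrightarrow> y \<in> V"
    using small_imp_in_neighbourhood[OF V(1,2)] by metis
  have lower: "\<delta> \<le> s" if s: "s \<in> S" for s
  proof (rule ccontr)
    assume "\<not> \<delta> \<le> s"
    then obtain h where h: "h \<in> H" "inv h \<otimes> m \<in> U" "norm (\<phi> (inv h \<otimes> m)) < \<delta>"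
      using s by (auto simp: S_def)
    then have "m \<otimes> inv (inv h \<otimes> m) \<in> carrier G - H" using \<delta> V by blast
    moreover have "m \<otimes> inv (inv h \<otimes> m) = h"
      using h mG H.mem_carrier by (simp add: inv_mult_group m_assoc[symmetric])
    ultimately show False using h(1) by simp
  qed
  have bdd: "bdd_below S" using lower by (rule bdd_belowI)
  have I: "\<delta> \<le> Inf S" using lower mS by (intro cInf_greatest) auto
  then have "Inf S < 3/2 * Inf S" using \<delta> by simp
  then obtain s where s: "s \<in> S" "s < 3/2 * Inf S" using cInf_lessD mS by blast
  then obtain h where h: "h \<in> H" "inv h \<otimes> m \<in> U" "norm (\<phi> (inv h \<otimes> m)) < 3/2 * Inf S"
    by (auto simp: S_def)
  show thesis
  proof (rule that[OF h(1,2)])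
    have "norm (\<phi> (inv h \<otimes> m)) \<in> S" using h by (auto simp: S_def)
    then show "\<phi> (inv h \<otimes> m) \<noteq> 0" using lower \<delta> by fastforce
    show "norm (\<phi> (inv h \<otimes> m)) \<le> 3/2 * norm (\<phi> m)"
      using h(3) cInf_lower[OF mS bdd] by linarith
    fix h' assume h': "h' \<in> H" "inv h' \<otimes> (inv h \<otimes> m) \<in> U"
    have eq: "inv h' \<otimes> (inv h \<otimes> m) = inv (h \<otimes> h') \<otimes> m"
      using h h' mG H.mem_carrier by (simp add: inv_mult_group m_assoc)
    have inS: "norm (\<phi> (inv h' \<otimes> (inv h \<otimes> m))) \<in> S"
      unfolding S_def using h h' eq by (intro image_eqI[of _ _ "h \<otimes> h'"]) auto
    show "norm (\<phi> (inv h \<otimes> m)) \<le> 3/2 * norm (\<phi> (inv h' \<otimes> (inv h \<otimes> m)))"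
      using h(3) cInf_lower[OF inS bdd] by linarith
  qed
qed

text \<open>Otherwise some \<open>w \<in> M\<close> arbitrarily close to \<open>\<one>\<close> are nearly shortest in their cosets modulo \<open>H\<close>. A limit of
  their directions is tangent to \<open>M\<close>, hence to \<open>H\<close>, and an element of \<open>H\<close> in that direction shortens \<open>w\<close>.\<close>

lemma closed_subgroup_contains_neighbourhood:
  assumes H: "subgroup H G" "closedin T H" and M: "subgroup M G" and HM: "H \<subseteq> M"
    and tan: "tangent_space M \<subseteq> tangent_space H"
  obtains W where "openin T W" "\<one> \<in> W" "M \<inter> W \<subseteq> H"
proof (rule ccontr)
  assume "\<not> thesis"
  then have no: "\<not> M \<inter> W \<subseteq> H" if "openin T W" "\<one> \<in> W" for W
    using \<open>\<And>W. openin T W \<Longrightarrow> \<one> \<in> W \<Longrightarrow> M \<inter> W \<subseteq> H \<Longrightarrow> thesis\<close> that by blast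
  interpret H: subgroup H G by fact
  interpret M: subgroup M G by fact
  have far: "\<exists>m \<in> M \<inter> U - H. norm (\<phi> m) < \<delta>" if delta: "\<delta> > 0" for \<delta>
  proof (rule ccontr)
    assume nex: "\<not> ?thesis"
    obtain W where W: "openin T W" "\<one> \<in> W" "W \<subseteq> U" "\<forall>y\<in>W. norm (\<phi> y) < \<delta>"
      using neighbourhood_small[OF delta] by metis
    then have "M \<inter> W \<subseteq> H" using nex by blast
    with no[OF W(1,2)] show False ..
  qed
  define good where "good w \<longleftrightarrow> w \<in> M \<inter> U \<and> \<phi> w \<noteq> 0 \<and>
      (\<forall>h\<in>H. inv h \<otimes> w \<in> U \<longrightarrow> norm (\<phi> w) \<le> 3/2 * norm (\<phi> (inv h \<otimes> w)))" for w
  have "\<exists>w. good w \<and> norm (\<phi> w) < inverse (real (Suc n))" for n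
  proof -
    \<comment> \<open>The 2/3 cancels the factor 3/2 lost in passing to a nearly shortest element of
      the coset.\<close>
    obtain m where m: "m \<in> M" "m \<in> U" "m \<notin> H" "norm (\<phi> m) < 2/3 * inverse (real (Suc n))"
      using far[of "2/3 * inverse (real (Suc n))"] by auto
    obtain h where h: "h \<in> H" "inv h \<otimes> m \<in> U" "\<phi> (inv h \<otimes> m) \<noteq> 0"
      "norm (\<phi> (inv h \<otimes> m)) \<le> 3/2 * norm (\<phi> m)"
      "\<And>h'. h' \<in> H \<Longrightarrow> inv h' \<otimes> (inv h \<otimes> m) \<in> U \<Longrightarrow>
        norm (\<phi> (inv h \<otimes> m)) \<le> 3/2 * norm (\<phi> (inv h' \<otimes> (inv h \<otimes> m)))"
      using closed_subgroup_near_optimal_quotient[OF H m(2,3)] by metis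
    have "inv h \<otimes> m \<in> M" using h(1) m(1) HM by auto
    then have "good (inv h \<otimes> m)" using h unfolding good_def by blast
    moreover have "norm (\<phi> (inv h \<otimes> m)) < inverse (real (Suc n))" using h(4) m(4) by linarith
    ultimately show ?thesis by blast
  qed
  then obtain w where w: "\<And>n. good (w n)" "\<And>n. norm (\<phi> (w n)) < inverse (real (Suc n))" by metis
  have w0: "(\<lambda>n. \<phi> (w n)) \<longlonglongrightarrow> 0"
    using w(2) by (intro Lim_null_comparison[OF _ LIMSEQ_inverse_real_of_nat]) (auto intro!: always_eventually less_imp_le)
  have "\<forall>n. sgn (\<phi> (w n)) \<in> sphere 0 1"
    using w(1) by (simp add: good_def norm_sgn)
  then obtain v r where r: "strict_mono r" and v: "((\<lambda>n. sgn (\<phi> (w n))) \<circ> r) \<longlonglongrightarrow> v"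
    using seq_compactE[OF compact_imp_seq_compact[OF compact_sphere]] by metis
  define u where "u n = w (r n)" for n
  have u: "good (u n)" for n using w by (simp add: u_def)
  have u0: "(\<lambda>n. \<phi> (u n)) \<longlonglongrightarrow> 0"
    using LIMSEQ_subseq_LIMSEQ[OF w0 r] by (simp add: u_def o_def)
  have usgn: "(\<lambda>n. sgn (\<phi> (u n))) \<longlonglongrightarrow> v" using v by (simp add: u_def o_def)
  have "v \<in> tangent_space M"
    by (rule sequential_direction_in_tangent_space[OF M _ _ u0 usgn])
      (use u in \<open>auto simp: good_def\<close>)
  then obtain \<gamma> where \<gamma>: "\<And>t. \<gamma> t \<in> H" "tangent \<gamma> v" using tan unfolding tangent_space_def by blast
  have tpos: "norm (\<phi> (u n)) > 0" for n using u[of n] by (simp add: good_def)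
  have tlim: "filterlim (\<lambda>n. norm (\<phi> (u n))) (at_right 0) sequentially"
    unfolding filterlim_at using tendsto_norm_zero[OF u0] tpos by auto
  \<comment> \<open>A crude relative error 1 suffices: the quotient then has norm at most twice the
    difference.\<close>
  obtain \<delta> where \<delta>: "\<delta> > 0" "\<And>x y. x \<in> U \<Longrightarrow> y \<in> U \<Longrightarrow> norm (\<phi> x) < \<delta> \<Longrightarrow> norm (\<phi> y) < \<delta> \<Longrightarrow>
    inv x \<otimes> y \<in> U \<and> norm (\<phi> (inv x \<otimes> y) - (\<phi> y - \<phi> x)) \<le> 1 * norm (\<phi> y - \<phi> x)"
    by (rule quotient_approx[of 1]) (simp, blast)
  have "(\<lambda>n. \<phi> (\<gamma> (norm (\<phi> (u n)))) /\<^sub>R norm (\<phi> (u n))) \<longlonglongrightarrow> v"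
    using filterlim_compose[OF conjunct2[OF \<gamma>(2)[unfolded tangent_def]] tlim] .
  from tendsto_diff[OF usgn this]
  have "(\<lambda>n. sgn (\<phi> (u n)) - \<phi> (\<gamma> (norm (\<phi> (u n)))) /\<^sub>R norm (\<phi> (u n))) \<longlonglongrightarrow> 0" by simp
  from tendstoD[OF this, of "1/4"]
  have "\<forall>\<^sub>F n in sequentially. norm (sgn (\<phi> (u n)) - \<phi> (\<gamma> (norm (\<phi> (u n)))) /\<^sub>R norm (\<phi> (u n))) < 1/4"
    by simp
  moreover have "\<forall>\<^sub>F n in sequentially. norm (\<phi> (u n)) < \<delta>"
    using tendstoD[OF u0 \<delta>(1)] by simp
  moreover have "\<forall>\<^sub>F n in sequentially. \<gamma> (norm (\<phi> (u n))) \<in> U \<and> norm (\<phi> (\<gamma> (norm (\<phi> (u n))))) < \<delta>"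
    using tangent_eventually_small[OF \<gamma>(2) \<delta>(1)] tlim unfolding filterlim_iff by blast
  ultimately have "\<forall>\<^sub>F n in sequentially. False"
  proof eventually_elim
    case (elim n)
    \<comment> \<open>At this time both \<phi> (\<gamma> t) and \<phi> (u n) are close to t v. Their
      difference is below t/4, so the quotient has norm below t/2, while near-minimality of u n
      gives t <= 3/2 times that norm, hence t < 3t/4.\<close>
    define t where "t = norm (\<phi> (u n))"
    have t: "t > 0" using tpos by (simp add: t_def)
    have "sgn (\<phi> (u n)) - \<phi> (\<gamma> t) /\<^sub>R t = (\<phi> (u n) - \<phi> (\<gamma> t)) /\<^sub>R t"
      by (simp add: sgn_div_norm t_def scaleR_diff_right)
    with elim(1) have "norm ((\<phi> (u n) - \<phi> (\<gamma> t)) /\<^sub>R t) < 1/4" by (simp only: t_def)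
    moreover have "norm ((\<phi> (u n) - \<phi> (\<gamma> t)) /\<^sub>R t) = norm (\<phi> (u n) - \<phi> (\<gamma> t)) / t"
      using t by (simp add: divide_inverse_commute)
    ultimately have close: "norm (\<phi> (u n) - \<phi> (\<gamma> t)) < t / 4" using t by (simp add: pos_divide_less_eq)
    have "inv (\<gamma> t) \<otimes> u n \<in> U \<and> norm (\<phi> (inv (\<gamma> t) \<otimes> u n) - (\<phi> (u n) - \<phi> (\<gamma> t))) \<le> 1 * norm (\<phi> (u n) - \<phi> (\<gamma> t))"
      using elim u[of n] by (intro \<delta>(2)) (auto simp: good_def t_def)
    then have q: "inv (\<gamma> t) \<otimes> u n \<in> U" "norm (\<phi> (inv (\<gamma> t) \<otimes> u n)) \<le> 2 * norm (\<phi> (u n) - \<phi> (\<gamma> t))"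
      using norm_triangle_ineq[of "\<phi> (inv (\<gamma> t) \<otimes> u n) - (\<phi> (u n) - \<phi> (\<gamma> t))" "\<phi> (u n) - \<phi> (\<gamma> t)"] by auto
    have "t \<le> 3/2 * norm (\<phi> (inv (\<gamma> t) \<otimes> u n))"
      using u[of n] q(1) \<gamma>(1) unfolding good_def t_def by blast
    with q(2) close t show False by linarith
  qed
  then show False by simp
qed

lemma closed_subgroup_eqI:
  assumes H: "subgroup H G" "closedin T H" and M: "subgroup M G" "connectedin T M" and HM: "H \<subseteq> M"
    and tan: "tangent_space M \<subseteq> tangent_space H"
  shows "H = M"
proof -
  interpret H: subgroup H G by fact
  obtain W where W: "openin T W" "\<one> \<in> W" "M \<inter> W \<subseteq> H"
    using closed_subgroup_contains_neighbourhood[OF H M(1) HM tan] by metis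
  show ?thesis
    by (rule connected_subgroup_induct[OF M W(1,2) HM]) (use W(3) in auto)
qed

end

section \<open>The adjoint representation\<close>

locale connected_chart = chart_at_identity +
  assumes connected: "connectedin T (carrier G)"
begin

text \<open>The chain rule along a curve: the remainder of the derivative is o(\<phi> (\<gamma> t)),
  hence o(t).\<close>

lemma conj_tangent_near_one:
  obtains W where "openin T W" "\<one> \<in> W"
    "\<And>x. x \<in> W \<Longrightarrow> \<exists>D. linear D \<and> (\<forall>\<gamma> v. tangent \<gamma> v \<longrightarrow> tangent (\<lambda>t. x \<otimes> \<gamma> t \<otimes> inv x) (D v))"
proof -
  obtain W where W: "openin T W" "\<one> \<in> W" "\<forall>x\<in>W. \<exists>D f.
      (f has_derivative D) (at 0) \<and> f 0 = 0 \<and>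
      (\<exists>\<delta>>0. \<forall>y\<in>U. norm (\<phi> y) < \<delta> \<longrightarrow>
        x \<otimes> y \<otimes> inv x \<in> U \<and> \<phi> (x \<otimes> y \<otimes> inv x) = f (\<phi> y))"
    using conj_differentiable by metis
  show thesis
  proof (rule that[OF W(1,2)])
    fix x assume "x \<in> W"
    with W(3) obtain D f \<delta> where D: "(f has_derivative D) (at 0)" "f 0 = 0" and \<delta>: "\<delta> > 0"
      and f: "\<And>y. y \<in> U \<Longrightarrow> norm (\<phi> y) < \<delta> \<Longrightarrow>
        x \<otimes> y \<otimes> inv x \<in> U \<and> \<phi> (x \<otimes> y \<otimes> inv x) = f (\<phi> y)"
      by metis
    have lin: "bounded_linear D" using D has_derivative_bounded_linear by blast
    have "tangent (\<lambda>t. x \<otimes> \<gamma> t \<otimes> inv x) (D v)" if \<gamma>: "tangent \<gamma> v" for \<gamma> v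
    proof -
      have ev: "\<forall>\<^sub>F t in at_right 0. x \<otimes> \<gamma> t \<otimes> inv x \<in> U \<and> \<phi> (x \<otimes> \<gamma> t \<otimes> inv x) = f (\<phi> (\<gamma> t))"
        using tangent_eventually_small[OF \<gamma> \<delta>] by eventually_elim (use f in blast)
      have lim: "((\<lambda>t. \<phi> (\<gamma> t) /\<^sub>R t) \<longlongrightarrow> v) (at_right 0)" using \<gamma> by (simp add: tangent_def)
      have "((\<lambda>t. (f (\<phi> (\<gamma> t)) - D (\<phi> (\<gamma> t))) /\<^sub>R t) \<longlongrightarrow> 0) (at_right 0)"
      proof (rule negligible_over_ident[OF _ lim])
        fix \<epsilon> :: real assume "\<epsilon> > 0"
        then obtain d where d: "d > 0" "\<And>y. norm y < d \<Longrightarrow> norm (f y - D y) \<le> \<epsilon> * norm y"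
          using D unfolding has_derivative_at_alt by (metis diff_zero)
        show "\<forall>\<^sub>F t in at_right 0. norm (f (\<phi> (\<gamma> t)) - D (\<phi> (\<gamma> t))) \<le> \<epsilon> * norm (\<phi> (\<gamma> t))"
          using tangent_eventually_small[OF \<gamma> d(1)] by eventually_elim (use d(2) in blast)
      qed
      moreover have "((\<lambda>t. D (\<phi> (\<gamma> t) /\<^sub>R t)) \<longlongrightarrow> D v) (at_right 0)"
        by (rule bounded_linear.tendsto[OF lin lim])
      ultimately have "((\<lambda>t. (f (\<phi> (\<gamma> t)) - D (\<phi> (\<gamma> t))) /\<^sub>R t + D (\<phi> (\<gamma> t) /\<^sub>R t)) \<longlongrightarrow> 0 + D v) (at_right 0)"
        by (rule tendsto_add)
      moreover have "(f (\<phi> (\<gamma> t)) - D (\<phi> (\<gamma> t))) /\<^sub>R t + D (\<phi> (\<gamma> t) /\<^sub>R t) = f (\<phi> (\<gamma> t)) /\<^sub>R t" for t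
        using linear_scale[OF bounded_linear.linear[OF lin]] by (simp add: scaleR_diff_right)
      ultimately have "((\<lambda>t. f (\<phi> (\<gamma> t)) /\<^sub>R t) \<longlongrightarrow> D v) (at_right 0)" by simp
      moreover have "\<forall>\<^sub>F t in at_right 0. f (\<phi> (\<gamma> t)) /\<^sub>R t = \<phi> (x \<otimes> \<gamma> t \<otimes> inv x) /\<^sub>R t"
        using ev by eventually_elim simp
      ultimately have "((\<lambda>t. \<phi> (x \<otimes> \<gamma> t \<otimes> inv x) /\<^sub>R t) \<longlongrightarrow> D v) (at_right 0)"
        by (rule Lim_transform_eventually)
      moreover have "\<forall>\<^sub>F t in at_right 0. x \<otimes> \<gamma> t \<otimes> inv x \<in> U"
        using ev by eventually_elim simp
      ultimately show ?thesis by (simp add: tangent_def)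
    qed
    then show "\<exists>D. linear D \<and> (\<forall>\<gamma> v. tangent \<gamma> v \<longrightarrow> tangent (\<lambda>t. x \<otimes> \<gamma> t \<otimes> inv x) (D v))"
      using bounded_linear.linear[OF lin] by blast
  qed
qed

text \<open>The chart describes conjugation only by x near \<one>. Composition of the linear maps
  carries the property along products, and connectedness reaches every x.\<close>

lemma conj_tangent:
  assumes "x \<in> carrier G"
  shows "\<exists>D. linear D \<and> (\<forall>\<gamma> v. tangent \<gamma> v \<longrightarrow> tangent (\<lambda>t. x \<otimes> \<gamma> t \<otimes> inv x) (D v))"
proof -
  define P where "P x D \<longleftrightarrow> linear D \<and> (\<forall>\<gamma> v. tangent \<gamma> v \<longrightarrow> tangent (\<lambda>t. x \<otimes> \<gamma> t \<otimes> inv x) (D v))"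
    for x D
  obtain W where W: "openin T W" "\<one> \<in> W" "\<And>x. x \<in> W \<Longrightarrow> \<exists>D. P x D"
    unfolding P_def by (rule conj_tangent_near_one) blast
  have "{x \<in> carrier G. \<exists>D. P x D} = carrier G"
  proof (rule connected_subgroup_induct[OF subgroup_self connected W(1,2)])
    fix x y assume "x \<in> {x \<in> carrier G. \<exists>D. P x D}" "y \<in> carrier G \<inter> W"
    then obtain D E where xy: "x \<in> carrier G" "y \<in> carrier G" and D: "P x D" and E: "P y E"
      using W(3) by blast
    have "tangent (\<lambda>t. x \<otimes> y \<otimes> \<gamma> t \<otimes> inv (x \<otimes> y)) ((D \<circ> E) v)" if \<gamma>: "tangent \<gamma> v" for \<gamma> v
    proof (rule tangent_cong)
      show "tangent (\<lambda>t. x \<otimes> (y \<otimes> \<gamma> t \<otimes> inv y) \<otimes> inv x) ((D \<circ> E) v)"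
        using D E \<gamma> unfolding P_def by simp
      have "\<forall>\<^sub>F t in at_right 0. \<gamma> t \<in> carrier G"
        using \<gamma> U_subset unfolding tangent_def by (auto elim!: eventually_mono)
      then show "\<forall>\<^sub>F t in at_right 0. x \<otimes> (y \<otimes> \<gamma> t \<otimes> inv y) \<otimes> inv x = x \<otimes> y \<otimes> \<gamma> t \<otimes> inv (x \<otimes> y)"
        by eventually_elim (simp add: xy m_assoc inv_mult_group)
    qed
    moreover have "linear (D \<circ> E)" using D E unfolding P_def by (blast intro: linear_compose)
    ultimately have "P (x \<otimes> y) (D \<circ> E)" unfolding P_def by blast
    then show "x \<otimes> y \<in> {x \<in> carrier G. \<exists>D. P x D}" using xy by blast
  qed (use W(2,3) in auto)
  then show ?thesis using assms unfolding P_def by blast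
qed

text \<open>The condition determines \<open>Ad x\<close> only on velocities of curves; elsewhere in
  the ambient space its values depend on the choice. Hence \<open>Ad_mult\<close> and
  \<open>Ad_one\<close> are stated on tangent spaces.\<close>

definition Ad :: "'a \<Rightarrow> 'c \<Rightarrow> 'c"
  where "Ad x = (SOME D. linear D \<and> (\<forall>\<gamma> v. tangent \<gamma> v \<longrightarrow> tangent (\<lambda>t. x \<otimes> \<gamma> t \<otimes> inv x) (D v)))"

lemma
  assumes "x \<in> carrier G"
  shows linear_Ad: "linear (Ad x)"
    and tangent_Ad: "tangent \<gamma> v \<Longrightarrow> tangent (\<lambda>t. x \<otimes> \<gamma> t \<otimes> inv x) (Ad x v)"
  using someI_ex[OF conj_tangent[OF assms]] unfolding Ad_def by blast+

lemma Ad_in_tangent_space: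
  assumes "N \<lhd> G" "x \<in> carrier G" "v \<in> tangent_space N"
  shows "Ad x v \<in> tangent_space N"
proof -
  obtain \<gamma> where \<gamma>: "\<forall>t. \<gamma> t \<in> N" "tangent \<gamma> v"
    using assms(3) unfolding tangent_space_def by blast
  have "\<forall>t. x \<otimes> \<gamma> t \<otimes> inv x \<in> N"
    using \<gamma> assms normal_inv_iff by blast
  then show ?thesis unfolding tangent_space_def using tangent_Ad[OF assms(2) \<gamma>(2)]
    by (intro CollectI exI[of _ "\<lambda>t. x \<otimes> \<gamma> t \<otimes> inv x"]) simp
qed

lemma Ad_mult:
  assumes xy: "x \<in> carrier G" "y \<in> carrier G" and v: "v \<in> tangent_space N" "N \<subseteq> carrier G"
  shows "Ad (x \<otimes> y) v = Ad x (Ad y v)"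
proof -
  obtain \<gamma> where \<gamma>: "\<And>t. \<gamma> t \<in> carrier G" "tangent \<gamma> v"
    using v unfolding tangent_space_def by blast
  have "tangent (\<lambda>t. x \<otimes> (y \<otimes> \<gamma> t \<otimes> inv y) \<otimes> inv x) (Ad x (Ad y v))"
    using xy \<gamma> by (intro tangent_Ad)
  moreover have "x \<otimes> (y \<otimes> \<gamma> t \<otimes> inv y) \<otimes> inv x = x \<otimes> y \<otimes> \<gamma> t \<otimes> inv (x \<otimes> y)" for t
    using xy \<gamma>(1) by (simp add: m_assoc inv_mult_group)
  ultimately show ?thesis
    using tangent_unique[OF tangent_Ad[OF _ \<gamma>(2), of "x \<otimes> y"]] xy by simp
qed

lemma Ad_one:
  assumes "v \<in> tangent_space N" "N \<subseteq> carrier G"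
  shows "Ad \<one> v = v"
proof -
  obtain \<gamma> where \<gamma>: "\<And>t. \<gamma> t \<in> carrier G" "tangent \<gamma> v"
    using assms unfolding tangent_space_def by blast
  have "tangent \<gamma> (Ad \<one> v)"
    using tangent_Ad[OF one_closed \<gamma>(2)] \<gamma>(1) by simp
  then show ?thesis using tangent_unique \<gamma>(2) by blast
qed

text \<open>The c(m) of the overview. Splitting off a factor on the left and conjugating the rest
  matches (m x)^(k+1) = (m x) (m x)^k.\<close>

primrec power_cocycle :: "'a \<Rightarrow> nat \<Rightarrow> 'a \<Rightarrow> 'a" where
  "power_cocycle x 0 m = \<one>"
| "power_cocycle x (Suc k) m = m \<otimes> (x \<otimes> power_cocycle x k m \<otimes> inv x)"

lemma power_cocycle_closed [simp]:
  "x \<in> carrier G \<Longrightarrow> m \<in> carrier G \<Longrightarrow> power_cocycle x k m \<in> carrier G"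
  by (induction k) auto

lemma power_cocycle_in_normal:
  assumes "N \<lhd> G" "x \<in> carrier G" "m \<in> N"
  shows "power_cocycle x k m \<in> N"
proof (induction k)
  case 0
  show ?case using assms(1) by (simp add: normal_imp_subgroup subgroup.one_closed)
next
  case (Suc k)
  then have "x \<otimes> power_cocycle x k m \<otimes> inv x \<in> N"
    using assms normal_inv_iff by blast
  then show ?case using assms by (simp add: normal_imp_subgroup subgroup.m_closed)
qed

lemma nat_pow_mult_eq_power_cocycle:
  assumes "x \<in> carrier G" "m \<in> carrier G"
  shows "(m \<otimes> x) [^] k = power_cocycle x k m \<otimes> x [^] k"
proof (induction k)
  case (Suc k)
  have "(m \<otimes> x) [^] Suc k = (m \<otimes> x) \<otimes> (power_cocycle x k m \<otimes> x [^] k)"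
    using assms Suc by (subst nat_pow_Suc2) auto
  also have "\<dots> = power_cocycle x (Suc k) m \<otimes> (x \<otimes> x [^] k)"
    using assms by (simp add: m_assoc inv_solve_left)
  also have "x \<otimes> x [^] k = x [^] Suc k"
    using assms by (subst nat_pow_Suc2) auto
  finally show ?case .
qed simp

text \<open>The L_x of the overview in Horner form, parallel to the recursion of
  \<open>power_cocycle\<close>, so that one induction computes the velocity of the latter.\<close>

primrec Ad_sum :: "'a \<Rightarrow> nat \<Rightarrow> 'c \<Rightarrow> 'c" where
  "Ad_sum x 0 v = 0"
| "Ad_sum x (Suc k) v = v + Ad x (Ad_sum x k v)"

lemma linear_Ad_sum:
  assumes "x \<in> carrier G"
  shows "linear (Ad_sum x k)"
proof (induction k)
  case 0
  show ?case by (simp add: linear_iff)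
next
  case (Suc k)
  then show ?case using linear_Ad[OF assms]
    by (simp add: linear_iff scaleR_add_right)
qed

lemma tangent_power_cocycle:
  assumes "x \<in> carrier G" "tangent \<gamma> v"
  shows "tangent (\<lambda>t. power_cocycle x k (\<gamma> t)) (Ad_sum x k v)"
proof (induction k)
  case 0
  show ?case by (simp add: tangent_one)
next
  case (Suc k)
  show ?case
    using tangent_mult[OF assms(2) tangent_Ad[OF assms(1) Suc]] by simp
qed

lemma Ad_sum_in_tangent_space:
  assumes "N \<lhd> G" "x \<in> carrier G" "v \<in> tangent_space N"
  shows "Ad_sum x k v \<in> tangent_space N"
proof -
  have s: "subspace (tangent_space N)"
    using assms(1) by (intro subspace_tangent_space normal_imp_subgroup)
  show ?thesis
    by (induction k) (use assms s Ad_in_tangent_space in \<open>auto simp: subspace_0 subspace_add\<close>)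
qed

lemma Ad_sum_one:
  assumes "N \<lhd> G" "v \<in> tangent_space N"
  shows "Ad_sum \<one> k v = real k *\<^sub>R v"
proof (induction k)
  case (Suc k)
  have "N \<subseteq> carrier G" using assms(1) normal_imp_subgroup subgroup.subset by blast
  moreover have "real k *\<^sub>R v \<in> tangent_space N"
    using assms subspace_tangent_space[OF normal_imp_subgroup] by (simp add: subspace_scale)
  ultimately show ?case using Suc Ad_one by (simp add: algebra_simps)
qed simp

text \<open>On the tangent space of \<open>N\<close>, \<open>Ad\<close> is a representation, so its
  matrix coefficients have finite rank by \<open>Ad_mult\<close>. Inserting an orthonormal basis
  between the factors of the Horner recursion makes the coefficients of \<open>Ad_sum\<close>
  polynomials in them.\<close>

lemma finite_rank_Ad_sum:
  assumes N: "N \<lhd> G" and uv: "v \<in> tangent_space N"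
  shows "finite_rank G (\<lambda>x. u \<bullet> Ad_sum x k v)"
proof -
  have NG: "N \<subseteq> carrier G" using N normal_imp_subgroup subgroup.subset by blast
  have s: "subspace (tangent_space N)"
    using N by (intro subspace_tangent_space normal_imp_subgroup)
  obtain B where B: "B \<subseteq> tangent_space N" "pairwise real_inner_class.orthogonal B"
      "\<And>x. x \<in> B \<Longrightarrow> norm x = 1" "independent B" "span B = tangent_space N"
    using orthonormal_basis_subspace[OF s] by metis
  have fin: "finite B" using B(4) by (rule independent_imp_finite)
  have coeff: "u \<bullet> Ad x w = (\<Sum>b\<in>B. (u \<bullet> Ad x b) * (b \<bullet> w))"
    if "x \<in> carrier G" "w \<in> tangent_space N" for u x w
  proof -
    have w: "w = (\<Sum>b\<in>B. (w \<bullet> b) *\<^sub>R b)"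
      using orthonormal_basis_expand[OF B(2,3) _ fin, of w] that B(5) by simp
    have "u \<bullet> Ad x w = u \<bullet> Ad x (\<Sum>b\<in>B. (w \<bullet> b) *\<^sub>R b)" using w by simp
    also have "\<dots> = (\<Sum>b\<in>B. (w \<bullet> b) * (u \<bullet> Ad x b))"
      using linear_Ad[OF that(1)] by (simp add: linear_sum linear_scale inner_sum_right)
    finally show ?thesis by (simp add: inner_commute mult.commute)
  qed
  have Ad: "finite_rank G (\<lambda>x. u \<bullet> Ad x b)" if "b \<in> tangent_space N" for u b
  proof (rule finite_rankI[OF fin])
    show "u \<bullet> Ad (x \<otimes> y) b = (\<Sum>c\<in>B. (u \<bullet> Ad x c) * (c \<bullet> Ad y b))"
      if "x \<in> carrier G" "y \<in> carrier G" for x y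
      using coeff[OF that(1) Ad_in_tangent_space[OF N that(2) \<open>b \<in> tangent_space N\<close>]]
        Ad_mult[OF that \<open>b \<in> tangent_space N\<close> NG] by simp
  qed
  show ?thesis
  \<comment> \<open>The recursion uses the hypothesis with basis vectors in place of u.\<close>
  proof (induction k arbitrary: u)
    case 0
    show ?case by (simp add: finite_rank_const)
  next
    case (Suc k)
    have "finite_rank G (\<lambda>x. u \<bullet> v + (\<Sum>b\<in>B. (u \<bullet> Ad x b) * (b \<bullet> Ad_sum x k v)))"
      using B(1) by (intro finite_rank_add finite_rank_const finite_rank_sum finite_rank_mult Suc.IH Ad) auto
    moreover have "u \<bullet> Ad_sum x (Suc k) v = u \<bullet> v + (\<Sum>b\<in>B. (u \<bullet> Ad x b) * (b \<bullet> Ad_sum x k v))"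
      if "x \<in> carrier G" for x
      using coeff[OF that Ad_sum_in_tangent_space[OF N that uv]] by (simp add: inner_add_right)
    \<comment> \<open>The two functions agree only on the carrier, which is all that
      \<open>finite_rank\<close> tests.\<close>
    ultimately show ?case
      unfolding finite_rank_def by simp
  qed
qed

section \<open>Descent along the derived series\<close>

text \<open>The comparison of tangent spaces needs surjectivity; the determinant yields injectivity,
  and a dimension count converts one into the other.\<close>

lemma generic_Ad_sum_surjective:
  assumes N: "N \<lhd> G" and k: "k > 0" and W: "openin T W" "W \<noteq> {}"
  obtains x where "x \<in> W" "Ad_sum x k ` tangent_space N = tangent_space N"
proof -
  have s: "subspace (tangent_space N)"
    using N by (intro subspace_tangent_space normal_imp_subgroup)
  obtain x where x: "x \<in> W" "\<And>v. v \<in> tangent_space N \<Longrightarrow> Ad_sum x k v = 0 \<Longrightarrow> v = 0"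
  proof (rule generic_nonsingular[OF connected s, of "\<lambda>x. Ad_sum x k" W])
    show "Ad_sum x k ` tangent_space N \<subseteq> tangent_space N" if "x \<in> carrier G" for x
      using Ad_sum_in_tangent_space[OF N that] by blast
    show "v = 0" if "v \<in> tangent_space N" "Ad_sum \<one> k v = 0" for v
      using Ad_sum_one[OF N that(1), of k] that(2) k by simp
  qed (use linear_Ad_sum finite_rank_Ad_sum N W in auto)
  have xG: "x \<in> carrier G" using x openin_subset[OF W(1)] by auto
  have lin: "linear (Ad_sum x k)" by (rule linear_Ad_sum[OF xG])
  have sub: "Ad_sum x k ` tangent_space N \<subseteq> tangent_space N"
    using Ad_sum_in_tangent_space[OF N xG] by blast
  have "inj_on (Ad_sum x k) (tangent_space N)"
    using linear_inj_on_iff_eq_0[OF lin s] x(2) by blast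
  then have "inj_on (Ad_sum x k) (span (tangent_space N))"
    using s by (simp add: span_eq_iff[THEN iffD2])
  then have "dim (Ad_sum x k ` tangent_space N) = dim (tangent_space N)"
    by (rule dim_image_eq[OF lin])
  then have "Ad_sum x k ` tangent_space N = tangent_space N"
    using sub s linear_subspace_image[OF lin s] by (intro subspace_dim_equal) auto
  with x(1) show thesis by (rule that)
qed

text \<open>Modulo \<open>N'\<close> elements of \<open>N\<close> commute, and conjugation by x is
  multiplicative. With \<open>A\<close>, \<open>B\<close> the conjugated cocycles of a and b, this
  turns a b A B into a A b B.\<close>

lemma power_cocycle_coset_hom:
  assumes N: "N \<lhd> G" and N': "N' \<lhd> G"
    and comm: "\<And>a b. a \<in> N \<Longrightarrow> b \<in> N \<Longrightarrow> a \<otimes> b \<otimes> inv a \<otimes> inv b \<in> N'"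
    and x: "x \<in> carrier G" and ab: "a \<in> N" "b \<in> N"
  shows "N' #> power_cocycle x k (a \<otimes> b) = N' #> (power_cocycle x k a \<otimes> power_cocycle x k b)"
proof (induction k)
  case 0
  show ?case by simp
next
  case (Suc k)
  interpret N: normal N G by fact
  interpret N': normal N' G by fact
  interpret Q: group "G Mod N'" by (rule N'.factorgroup_is_group)
  define q where "q g = N' #> g" for g
  have q: "q g \<in> carrier (G Mod N')" if "g \<in> carrier G" for g
    using N'.r_coset_hom_Mod that by (auto simp: hom_def q_def)
  have qm: "q (g \<otimes> h) = q g \<otimes>\<^bsub>G Mod N'\<^esub> q h" if "g \<in> carrier G" "h \<in> carrier G" for g h
    using N'.r_coset_hom_Mod that by (auto simp: hom_def q_def)
  have cancel: "inv g \<otimes> (g \<otimes> h) = h" if "g \<in> carrier G" "h \<in> carrier G" for g h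
    using that by (simp add: m_assoc[symmetric])
  have qc: "q (g \<otimes> h) = q (h \<otimes> g)" if "g \<in> N" "h \<in> N" for g h
  proof -
    have c: "g \<in> carrier G" "h \<in> carrier G" using that by auto
    have "g \<otimes> h = (g \<otimes> h \<otimes> inv g \<otimes> inv h) \<otimes> (h \<otimes> g)"
      using c by (simp add: m_assoc cancel)
    then have "g \<otimes> h \<in> N' #> (h \<otimes> g)"
      using comm[OF that] unfolding r_coset_def by blast
    then show ?thesis unfolding q_def
      using c repr_independence[OF _ _ N'.subgroup_axioms, of "g \<otimes> h" "h \<otimes> g"] by simp
  qed
  define A B where "A = x \<otimes> power_cocycle x k a \<otimes> inv x" and "B = x \<otimes> power_cocycle x k b \<otimes> inv x"
  have AB: "A \<in> N" "B \<in> N"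
    unfolding A_def B_def using N x ab power_cocycle_in_normal normal_inv_iff by blast+
  have c: "A \<in> carrier G" "B \<in> carrier G" "a \<in> carrier G" "b \<in> carrier G"
    using AB ab by auto
  have "q (x \<otimes> power_cocycle x k (a \<otimes> b) \<otimes> inv x) = q (x \<otimes> (power_cocycle x k a \<otimes> power_cocycle x k b) \<otimes> inv x)"
    using Suc x c by (simp add: qm q_def[symmetric])
  also have "x \<otimes> (power_cocycle x k a \<otimes> power_cocycle x k b) \<otimes> inv x = A \<otimes> B"
    unfolding A_def B_def using x c by (simp add: m_assoc cancel)
  finally have conj: "q (x \<otimes> power_cocycle x k (a \<otimes> b) \<otimes> inv x) = q (A \<otimes> B)" .
  have "q (power_cocycle x (Suc k) (a \<otimes> b)) = q ((a \<otimes> b) \<otimes> (A \<otimes> B))"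
    using conj x c by (simp add: qm)
  also have "(a \<otimes> b) \<otimes> (A \<otimes> B) = a \<otimes> (b \<otimes> A) \<otimes> B" using c by (simp add: m_assoc)
  also have "q (a \<otimes> (b \<otimes> A) \<otimes> B) = q (a \<otimes> (A \<otimes> b) \<otimes> B)"
    using c qc[OF ab(2) AB(1)] by (simp add: qm[of _ B] qm[of a])
  also have "a \<otimes> (A \<otimes> b) \<otimes> B = (a \<otimes> A) \<otimes> (b \<otimes> B)" using c by (simp add: m_assoc)
  finally show ?case by (simp add: q_def A_def B_def)
qed

lemma subgroup_power_cocycle_cosets:
  assumes N: "N \<lhd> G" and N': "N' \<lhd> G" "N' \<subseteq> N"
    and comm: "\<And>a b. a \<in> N \<Longrightarrow> b \<in> N \<Longrightarrow> a \<otimes> b \<otimes> inv a \<otimes> inv b \<in> N'"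
    and x: "x \<in> carrier G"
  shows "subgroup {m' \<otimes> power_cocycle x k m | m' m. m' \<in> N' \<and> m \<in> N} G"
    (is "subgroup ?K G")
proof -
  interpret N: normal N G by fact
  interpret N': normal N' G by fact
  interpret Q: group "G Mod N'" by (rule N'.factorgroup_is_group)
  define q where "q g = N' #> g" for g
  have q: "q g \<in> carrier (G Mod N')" if "g \<in> carrier G" for g
    using N'.r_coset_hom_Mod that by (auto simp: hom_def q_def)
  have qm: "q (g \<otimes> h) = q g \<otimes>\<^bsub>G Mod N'\<^esub> q h" if "g \<in> carrier G" "h \<in> carrier G" for g h
    using N'.r_coset_hom_Mod that by (auto simp: hom_def q_def)
  \<comment> \<open>\<open>?K\<close> is the preimage in G of the image of \<open>N\<close> under m
    \<mapsto> q (c(m)), a homomorphism into the factor group; the subgroup laws follow from this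
    description.\<close>
  have K: "g \<in> ?K \<longleftrightarrow> g \<in> carrier G \<and> (\<exists>m\<in>N. q g = q (power_cocycle x k m))" for g
  proof
    assume "g \<in> ?K"
    then obtain m' m where m: "m' \<in> N'" "m \<in> N" "g = m' \<otimes> power_cocycle x k m" by blast
    then have "g \<in> N' #> power_cocycle x k m" unfolding r_coset_def by blast
    then have "q g = q (power_cocycle x k m)" unfolding q_def
      using repr_independence[OF _ _ N'.subgroup_axioms, of g "power_cocycle x k m"] x m by simp
    then show "g \<in> carrier G \<and> (\<exists>m\<in>N. q g = q (power_cocycle x k m))" using m x by auto
  next
    assume "g \<in> carrier G \<and> (\<exists>m\<in>N. q g = q (power_cocycle x k m))"
    then obtain m where m: "g \<in> carrier G" "m \<in> N" "N' #> g = N' #> power_cocycle x k m"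
      unfolding q_def by blast
    then have "g \<in> N' #> power_cocycle x k m" using rcos_self[OF m(1) N'.subgroup_axioms] by simp
    then show "g \<in> ?K" using m(2) unfolding r_coset_def by blast
  qed
  have hom: "q (power_cocycle x k (a \<otimes> b)) = q (power_cocycle x k a) \<otimes>\<^bsub>G Mod N'\<^esub> q (power_cocycle x k b)"
    if "a \<in> N" "b \<in> N" for a b
  proof -
    have "q (power_cocycle x k (a \<otimes> b)) = q (power_cocycle x k a \<otimes> power_cocycle x k b)"
      unfolding q_def by (rule power_cocycle_coset_hom[OF N N'(1) comm x that])
    also have "\<dots> = q (power_cocycle x k a) \<otimes>\<^bsub>G Mod N'\<^esub> q (power_cocycle x k b)"
      using that x by (intro qm) auto
    finally show ?thesis .
  qed
  have one: "power_cocycle x k \<one> = \<one>" for k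
    using x by (induction k) auto
  show ?thesis
  proof
    show "?K \<subseteq> carrier G" using K by blast
    have "q \<one> = q (power_cocycle x k \<one>)" by (simp only: one)
    then show "\<one> \<in> ?K" unfolding K using N.one_closed one_closed by blast
    show "g \<otimes> h \<in> ?K" if gh: "g \<in> ?K" "h \<in> ?K" for g h
    proof -
      obtain a b where "g \<in> carrier G" "h \<in> carrier G" "a \<in> N" "b \<in> N"
        "q g = q (power_cocycle x k a)" "q h = q (power_cocycle x k b)"
        using gh unfolding K by blast
      then have "q (g \<otimes> h) = q (power_cocycle x k (a \<otimes> b))" by (simp add: qm hom del: mult_FactGroup)
      with \<open>g \<in> carrier G\<close> \<open>h \<in> carrier G\<close> \<open>a \<in> N\<close> \<open>b \<in> N\<close> show ?thesis unfolding K by blast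
    qed
    show "inv g \<in> ?K" if g: "g \<in> ?K" for g
    proof -
      obtain a where a: "g \<in> carrier G" "a \<in> N" "q g = q (power_cocycle x k a)"
        using g unfolding K by blast
      \<comment> \<open>Both candidates for the inverse class give the neutral class when multiplied
        by \<open>q g\<close>, so \<open>q g\<close> can be cancelled.\<close>
      have "q (inv g) \<otimes>\<^bsub>G Mod N'\<^esub> q g = q (power_cocycle x k (inv a)) \<otimes>\<^bsub>G Mod N'\<^esub> q g"
      proof -
        have "q (inv g) \<otimes>\<^bsub>G Mod N'\<^esub> q g = q \<one>"
          using a(1) qm[of "inv g" g] by (simp del: mult_FactGroup)
        also have "\<dots> = q (power_cocycle x k (inv a)) \<otimes>\<^bsub>G Mod N'\<^esub> q g"
          using a hom[of "inv a" a] one by (simp del: mult_FactGroup)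
        finally show ?thesis .
      qed
      then have "q (inv g) = q (power_cocycle x k (inv a))"
        using a x q by (simp only: Q.right_cancel power_cocycle_closed inv_closed N.mem_carrier N.m_inv_closed)
      then show ?thesis unfolding K using a N.m_inv_closed by blast
    qed
  qed
qed

lemma closure_of_power_cocycle_cosets:
  assumes N: "N \<lhd> G" "closedin T N" "connectedin T N" and N': "N' \<lhd> G" "N' \<subseteq> N"
    and comm: "\<And>a b. a \<in> N \<Longrightarrow> b \<in> N \<Longrightarrow> a \<otimes> b \<otimes> inv a \<otimes> inv b \<in> N'"
    and x: "x \<in> carrier G" "Ad_sum x k ` tangent_space N = tangent_space N"
  shows "T closure_of {m' \<otimes> power_cocycle x k m | m' m. m' \<in> N' \<and> m \<in> N} = N"
    (is "T closure_of ?K = N")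
proof (rule closed_subgroup_eqI)
  interpret N: normal N G by fact
  interpret N': normal N' G by fact
  have K: "subgroup ?K G" by (rule subgroup_power_cocycle_cosets[OF N(1) N' comm x(1)])
  show "subgroup (T closure_of ?K) G" by (rule subgroup_closure_of[OF K])
  have "?K \<subseteq> N" using power_cocycle_in_normal[OF N(1) x(1)] N'(2) by auto
  then show "T closure_of ?K \<subseteq> N" using N(2) by (simp add: closure_of_minimal)
  show "tangent_space N \<subseteq> tangent_space (T closure_of ?K)"
  proof
    fix w assume "w \<in> tangent_space N"
    then obtain v where v: "v \<in> tangent_space N" "w = Ad_sum x k v" using x(2) by blast
    then obtain \<gamma> where \<gamma>: "\<And>t. \<gamma> t \<in> N" "tangent \<gamma> v" unfolding tangent_space_def by blast
    have tan: "tangent (\<lambda>t. power_cocycle x k (\<gamma> t)) w"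
      using tangent_power_cocycle[OF x(1) \<gamma>(2)] v(2) by simp
    have inK: "\<forall>t. power_cocycle x k (\<gamma> t) \<in> ?K"
    proof
      fix t
      have "\<one> \<otimes> power_cocycle x k (\<gamma> t) \<in> ?K" using \<gamma>(1) N'.one_closed by blast
      then show "power_cocycle x k (\<gamma> t) \<in> ?K" using x(1) \<gamma>(1) by simp
    qed
    have "w \<in> tangent_space ?K"
      unfolding tangent_space_def by (rule CollectI, rule exI, rule conjI[OF inK tan])
    moreover have "?K \<subseteq> T closure_of ?K"
      using subgroup.subset[OF K] by (intro closure_of_subset) simp
    ultimately show "w \<in> tangent_space (T closure_of ?K)" using tangent_space_mono by blast
  qed
qed (use N normal_imp_subgroup in auto)

text \<open>For normal \<open>N\<close>, density of the k-th powers in G/N, expressed inside G so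
  that all stages of the descent share one topology. The stage \<open>R\<close> is the hypothesis on
  G/R, the stage of the trivial subgroup the density in G.\<close>

definition dense_powers_modulo :: "nat \<Rightarrow> 'a set \<Rightarrow> bool"
  where "dense_powers_modulo k N \<longleftrightarrow>
    (\<forall>W. openin T W \<longrightarrow> W \<noteq> {} \<longrightarrow> (\<exists>x\<in>carrier G. \<exists>m\<in>N. m \<otimes> x [^] k \<in> W))"

lemma dense_powers_modulo_step:
  assumes N: "N \<lhd> G" "closedin T N" "connectedin T N" and N': "N' \<lhd> G" "N' \<subseteq> N"
    and comm: "\<And>a b. a \<in> N \<Longrightarrow> b \<in> N \<Longrightarrow> a \<otimes> b \<otimes> inv a \<otimes> inv b \<in> N'"
    and k: "k > 0" and dense: "dense_powers_modulo k N"
  shows "dense_powers_modulo k N'"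
  unfolding dense_powers_modulo_def
proof (intro allI impI)
  fix W assume W: "openin T W" "W \<noteq> {}"
  interpret N: normal N G by fact
  interpret N': normal N' G by fact
  obtain x0 m where m: "x0 \<in> carrier G" "m \<in> N" "m \<otimes> x0 [^] k \<in> W"
    using dense W unfolding dense_powers_modulo_def by blast
  \<comment> \<open>With m fixed, x0 may be replaced by any x in this nonempty open set, hence by
    one with surjective \<open>Ad_sum\<close>.\<close>
  let ?V = "{x \<in> carrier G. m \<otimes> x [^] k \<in> W}"
  have "continuous_map T T (\<lambda>x. m \<otimes> x [^] k)"
    using m(2) by (intro continuous_map_mult continuous_map_nat_pow) auto
  from openin_continuous_map_preimage[OF this W(1)] have "openin T ?V" by simp
  moreover have "?V \<noteq> {}" using m by blast
  ultimately obtain x where x: "x \<in> ?V" "Ad_sum x k ` tangent_space N = tangent_space N"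
    using generic_Ad_sum_surjective[OF N(1) k] by blast
  let ?K = "{m' \<otimes> power_cocycle x k m | m' m. m' \<in> N' \<and> m \<in> N}"
  have xG: "x \<in> carrier G" using x by blast
  have "openin T {y \<in> carrier G. y \<otimes> x [^] k \<in> W}"
    using xG W(1) by (intro openin_preimage_rtrans) auto
  moreover have "m \<in> {y \<in> carrier G. y \<otimes> x [^] k \<in> W}" using x m by auto
  moreover have "m \<in> T closure_of ?K"
    using closure_of_power_cocycle_cosets[OF N N' comm xG x(2)] m(2) by simp
  ultimately have "\<exists>y. y \<in> ?K \<and> y \<in> {y \<in> carrier G. y \<otimes> x [^] k \<in> W}"
    unfolding in_closure_of by meson
  then obtain y where y: "y \<in> ?K" "y \<otimes> x [^] k \<in> W" by blast
  then obtain m' n where n: "m' \<in> N'" "n \<in> N" "y = m' \<otimes> power_cocycle x k n" by blast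
  have "m' \<otimes> (n \<otimes> x) [^] k = y \<otimes> x [^] k"
    using n xG N'.mem_carrier N.mem_carrier by (simp add: nat_pow_mult_eq_power_cocycle m_assoc)
  with y n xG show "\<exists>x\<in>carrier G. \<exists>m\<in>N'. m \<otimes> x [^] k \<in> W"
    by (intro bexI[of _ "n \<otimes> x"] bexI[of _ m']) auto
qed

lemma dense_powers_modulo_mono:
  "N \<subseteq> N' \<Longrightarrow> dense_powers_modulo k N \<Longrightarrow> dense_powers_modulo k N'"
  unfolding dense_powers_modulo_def by blast

text \<open>The chain consists of the closures of the algebraic derived series. By continuity
  commutators of one closure lie in the next, so solvability ends the chain at the closure of the
  trivial subgroup, which is trivial in a Hausdorff space.\<close>

lemma dense_powers_of_solvable:
  assumes haus: "Hausdorff_space T"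
    and R: "R \<lhd> G" "connectedin T R" "solvable (G\<lparr>carrier := R\<rparr>)"
    and k: "k > 0" and dense: "dense_powers_modulo k R"
  shows "dense_powers_modulo k {\<one>}"
proof -
  define D where "D j = (derived G ^^ j) R" for j
  have D: "D j \<lhd> G \<and> connectedin T (D j)" for j
  proof (induction j)
    case 0
    then show ?case using R by (simp add: D_def)
  next
    case (Suc j)
    have "D (Suc j) = derived G (D j)" by (simp add: D_def)
    then show ?case
      using Suc derived_is_normal connectedin_derived normal_imp_subgroup by metis
  qed
  have step: "dense_powers_modulo k (T closure_of D j)" for j
  proof (induction j)
    case 0
    have "R \<subseteq> T closure_of R"
      using R(1) normal_imp_subgroup subgroup.subset by (intro closure_of_subset) fastforce
    then show ?case using dense dense_powers_modulo_mono by (simp add: D_def)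
  next
    case (Suc j)
    have "derived G (D j) \<subseteq> D j"
      using D by (intro derived_incl) (auto simp: normal_imp_subgroup)
    then have sub: "T closure_of D (Suc j) \<subseteq> T closure_of D j"
      by (intro closure_of_mono) (simp add: D_def)
    show ?case
    proof (rule dense_powers_modulo_step[OF _ _ _ _ sub _ k Suc])
      show "T closure_of D j \<lhd> G" "T closure_of D (Suc j) \<lhd> G" using D normal_closure_of by blast+
      show "connectedin T (T closure_of D j)" using D connectedin_closure_of by blast
      show "a \<otimes> b \<otimes> inv a \<otimes> inv b \<in> T closure_of D (Suc j)"
        if "a \<in> T closure_of D j" "b \<in> T closure_of D j" for a b
        using commutator_closure_of[OF that] by (simp add: D_def)
    qed simp
  qed
  have sub: "subgroup R G" using R(1) by (rule normal_imp_subgroup)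
  interpret R: group "G\<lparr>carrier := R\<rparr>" by (rule subgroup.subgroup_is_group[OF sub is_group])
  obtain n where n: "(derived (G\<lparr>carrier := R\<rparr>) ^^ n) R = {\<one>}"
    using R(3) unfolding R.solvable_iff_trivial_derived_seq by auto
  \<comment> \<open>Solvability speaks of \<open>R\<close> as a group of its own; its derived series
    agrees with the one formed in G.\<close>
  have "(derived (G\<lparr>carrier := R\<rparr>) ^^ j) R = D j \<and> D j \<subseteq> R" for j
  proof (induction j)
    case (Suc j)
    then show ?case
      using derived_consistent[OF _ sub] derived_incl[OF _ sub] by (simp add: D_def)
  qed (simp add: D_def)
  with n have "D n = {\<one>}" by metis
  moreover have "T closure_of {\<one>} = {\<one>}"
    using haus by (simp add: closedin_Hausdorff_singleton closure_of_closedin)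
  ultimately show ?thesis using step[of n] by simp
qed

end

section \<open>Charts of Lie groups\<close>

text \<open>Continuity of the derivative allows both x and y to vary near z, by the mean value
  inequality. This uniformity is needed since \<open>mult_approx\<close> compares two points neither
  of which is the base point.\<close>

lemma strict_derivative:
  fixes F :: "'e::euclidean_space \<Rightarrow> 'f::euclidean_space"
  assumes W: "open W" "z \<in> W" and F: "times_cont_diff_on 1 W F"
  obtains D where "linear D"
    "\<And>\<epsilon>. \<epsilon> > 0 \<Longrightarrow> \<exists>\<delta>>0. \<forall>x\<in>ball z \<delta>. \<forall>y\<in>ball z \<delta>. norm (F y - F x - D (y - x)) \<le> \<epsilon> * norm (y - x)"
proof -
  define D where "D = (\<lambda>x. frechet_derivative F (at x))"
  have der: "(F has_derivative D x) (at x)" if "x \<in> W" for x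
    using F that unfolding D_def by (simp add: frechet_derivative_works[symmetric])
  have cont: "continuous_on W (\<lambda>x. D x v)" for v
    using F by (simp add: D_def)
  have lin: "linear (D x)" if "x \<in> W" for x
    using der[OF that] has_derivative_linear by blast
  have "\<exists>\<delta>>0. \<forall>x\<in>ball z \<delta>. \<forall>y\<in>ball z \<delta>. norm (F y - F x - D z (y - x)) \<le> \<epsilon> * norm (y - x)"
    if eps: "\<epsilon> > 0" for \<epsilon>
  proof -
    \<comment> \<open>Bounds the operator norm of \<open>D x - D z\<close>, is continuous, and
      vanishes at z.\<close>
    define S where "S x = (\<Sum>i\<in>Basis. norm (D x i - D z i))" for x
    have "continuous_on W S" unfolding S_def by (intro continuous_intros cont)
    then have "isCont S z" using W by (simp add: continuous_on_eq_continuous_at)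
    moreover have "S z = 0" by (simp add: S_def)
    ultimately have "\<forall>\<^sub>F x in at z. dist (S x) 0 < \<epsilon>"
      using eps unfolding isCont_def by (auto dest: tendstoD)
    then obtain d where d: "d > 0" "\<And>x. x \<noteq> z \<Longrightarrow> dist x z < d \<Longrightarrow> dist (S x) 0 < \<epsilon>"
      unfolding eventually_at by auto
    obtain d' where d': "d' > 0" "ball z d' \<subseteq> W" using W open_contains_ball by blast
    define \<delta> where "\<delta> = min d d'"
    have \<delta>: "\<delta> > 0" "ball z \<delta> \<subseteq> W" using d d' by (auto simp: \<delta>_def)
    have small: "S x \<le> \<epsilon>" if "x \<in> ball z \<delta>" for x
      using d(2)[of x] that eps \<open>S z = 0\<close>
      by (cases "x = z") (auto simp: \<delta>_def dist_commute dist_real_def)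
    have onorm: "onorm (D x - D z) \<le> \<epsilon>" if x: "x \<in> ball z \<delta>" for x
    proof (rule onorm_le)
      fix v :: 'e
      have l: "linear (\<lambda>v. D x v - D z v)"
        using lin x \<delta>(2) W(2) by (intro linear_compose_sub) auto
      have "(D x - D z) v = (\<Sum>i\<in>Basis. (v \<bullet> i) *\<^sub>R (D x i - D z i))"
        using linear_sum[OF l, of "\<lambda>i. (v \<bullet> i) *\<^sub>R i" Basis] linear_scale[OF l]
        by (simp add: euclidean_representation)
      also have "norm \<dots> \<le> (\<Sum>i\<in>Basis. norm ((v \<bullet> i) *\<^sub>R (D x i - D z i)))"
        by (rule norm_sum)
      also have "\<dots> \<le> (\<Sum>i\<in>Basis. norm v * norm (D x i - D z i))"
        by (intro sum_mono) (auto intro!: mult_right_mono Basis_le_norm)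
      also have "\<dots> = norm v * S x" by (simp add: S_def sum_distrib_left)
      also have "\<dots> \<le> norm v * \<epsilon>" using small[OF x] by (intro mult_left_mono) auto
      finally show "norm ((D x - D z) v) \<le> \<epsilon> * norm v" by (simp add: mult.commute)
    qed
    have "norm (F y - F x - D z (y - x)) \<le> \<epsilon> * norm (y - x)"
      if xy: "x \<in> ball z \<delta>" "y \<in> ball z \<delta>" for x y
    proof -
      have seg: "x + t *\<^sub>R (y - x) \<in> ball z \<delta>" if "t \<in> {0..1}" for t
      proof -
        have "x + t *\<^sub>R (y - x) = (1 - t) *\<^sub>R x + t *\<^sub>R y" by (simp add: algebra_simps)
        then show ?thesis using that convexD_alt[OF convex_ball xy, of t] by simp
      qed
      have "norm (F y - F x - D z (y - x)) \<le> norm (y - x) * \<epsilon>"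
      proof (rule differentiable_bound_linearization[where S = "ball z \<delta>" and f' = D])
        show "(F has_derivative D x) (at x within ball z \<delta>)" if "x \<in> ball z \<delta>" for x
          using der \<delta>(2) that has_derivative_at_withinI by blast
        show "onorm (D x - D z) \<le> \<epsilon>" if "x \<in> ball z \<delta>" for x
          using onorm[OF that] .
      qed (use seg \<delta>(1) in auto)
      then show ?thesis by (simp add: mult.commute)
    qed
    then show ?thesis using \<delta>(1) by blast
  qed
  then show thesis using that[of "D z"] lin[OF W(2)] by blast
qed

lemma lie_group_imp_continuous_group: "lie_group G T A \<Longrightarrow> continuous_group G T"
  by (simp add: lie_group_def smooth_map_def continuous_group_def continuous_group_axioms_def)

text \<open>Multiplication in a chart extends to a smooth \<open>F\<close> on an open set of the
  ambient product. Strict differentiability of \<open>F\<close> at (p, p) gives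
  \<open>mult_approx\<close>; composing \<open>F\<close> with itself gives differentiability of
  conjugation. The new chart is the old one shifted to send \<one> to 0.\<close>

lemma lie_group_chart_at_identity:
  fixes G :: "('a, 'm) monoid_scheme" (structure) and A :: "('a, 'e::euclidean_space) chart set"
  assumes G: "lie_group G T A"
  obtains U and \<phi> :: "'a \<Rightarrow> 'e" where "chart_at_identity G T U \<phi>"
proof -
  interpret continuous_group G T using lie_group_imp_continuous_group[OF G] .
  obtain V where V: "subspace V" "smooth_atlas T V A"
    using G unfolding lie_group_def smooth_manifold_def by blast
  have "\<one> \<in> (\<Union>(U, \<phi>)\<in>A. U)" using V(2) by (simp add: smooth_atlas_def)
  then obtain U \<psi> where U: "(U, \<psi>) \<in> A" "\<one> \<in> U" by auto
  have "is_chart T V (U, \<psi>)" using V(2) U(1) unfolding smooth_atlas_def by blast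
  then have openU: "openin T U" and openV: "openin (top_of_set V) (\<psi> ` U)"
    and hom: "homeomorphic_map (subtopology T U) (top_of_set (\<psi> ` U)) \<psi>"
    unfolding is_chart_def by auto
  have UG: "U \<subseteq> carrier G" using openin_subset[OF openU] by simp
  then have topU: "topspace (subtopology T U) = U" by auto
  have inj: "inj_on \<psi> U" using homeomorphic_imp_injective_map[OF hom] topU by simp
  have \<psi>V: "\<psi> y \<in> V" if "y \<in> U" for y using openin_imp_subset[OF openV] that by blast
  define p where "p = \<psi> \<one>"
  define \<phi> where "\<phi> y = \<psi> y - p" for y
  have \<psi>: "\<psi> y = p + \<phi> y" for y by (simp add: \<phi>_def)
  have \<phi>V: "\<phi> y \<in> V" if "y \<in> U" for y
    unfolding \<phi>_def p_def using \<psi>V that U(2) V(1) by (intro subspace_diff) auto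
  \<comment> \<open>The chart image is relatively open in \<open>V\<close>, so every small vector of
    \<open>V\<close> is the displacement of a point of \<open>W\<close>.\<close>
  have nbhd: "\<exists>\<delta>>0. \<forall>v\<in>V. norm v < \<delta> \<longrightarrow> p + v \<in> \<psi> ` (W \<inter> U)"
    if W: "openin T W" "\<one> \<in> W" for W
  proof -
    have "openin (subtopology T U) (W \<inter> U)" using W by (auto simp: openin_subtopology)
    then have "openin (top_of_set (\<psi> ` U)) (\<psi> ` (W \<inter> U))"
      using homeomorphic_map_openness_eq[OF hom] by blast
    then have "openin (top_of_set V) (\<psi> ` (W \<inter> U))" using openV openin_trans by blast
    moreover have "p \<in> \<psi> ` (W \<inter> U)" using W U by (auto simp: p_def)
    ultimately obtain e where e: "e > 0" "ball p e \<inter> V \<subseteq> \<psi> ` (W \<inter> U)"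
      unfolding openin_contains_ball by blast
    have "p + v \<in> \<psi> ` (W \<inter> U)" if "v \<in> V" "norm v < e" for v
    proof -
      have "p + v \<in> V" using that(1) \<psi>V[OF U(2)] V(1) by (simp add: p_def subspace_add)
      then show ?thesis using that(2) e(2) by (auto simp: dist_norm)
    qed
    then show ?thesis using e(1) by blast
  qed
  have small: "\<exists>\<delta>>0. \<forall>y\<in>U. norm (\<phi> y) < \<delta> \<longrightarrow> y \<in> W" if W: "openin T W" "\<one> \<in> W" for W
  proof -
    obtain \<delta> where \<delta>: "\<delta> > 0" "\<And>v. v \<in> V \<Longrightarrow> norm v < \<delta> \<Longrightarrow> p + v \<in> \<psi> ` (W \<inter> U)"
      using nbhd[OF W] by blast
    have "y \<in> W" if "y \<in> U" "norm (\<phi> y) < \<delta>" for y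
      using \<delta>(2)[OF \<phi>V[OF that(1)] that(2)] inj that(1) by (auto simp: \<psi>[symmetric] inj_on_def)
    then show ?thesis using \<delta>(1) by blast
  qed
  have near: "\<exists>W. openin T W \<and> \<one> \<in> W \<and> W \<subseteq> U \<and> (\<forall>y\<in>W. norm (\<phi> y) < \<delta>)" if "\<delta> > 0" for \<delta>
  proof -
    have "continuous_map (subtopology T U) (top_of_set (\<psi> ` U)) \<psi>"
      using hom homeomorphic_imp_continuous_map by blast
    then have "openin (subtopology T U) {y \<in> topspace (subtopology T U). \<psi> y \<in> \<psi> ` U \<inter> ball p \<delta>}"
      by (rule openin_continuous_map_preimage) (simp add: openin_open_Int)
    then have "openin T {y \<in> U. \<psi> y \<in> \<psi> ` U \<inter> ball p \<delta>}"
      unfolding topU by (rule openin_trans_full[OF _ openU])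
    moreover have "\<one> \<in> {y \<in> U. \<psi> y \<in> \<psi> ` U \<inter> ball p \<delta>}" using U that by (simp add: p_def)
    ultimately show ?thesis
      by (intro exI[of _ "{y \<in> U. \<psi> y \<in> \<psi> ` U \<inter> ball p \<delta>}"]) (auto simp: \<phi>_def dist_norm norm_minus_commute)
  qed
  let ?mult = "\<lambda>(x, y). x \<otimes> y"
  have "(U \<times> U, map_prod \<psi> \<psi>) \<in> product_atlas A A" using U unfolding product_atlas_def by blast
  then have "smooth_on (map_prod \<psi> \<psi> ` (U \<times> U \<inter> ?mult -` U)) (\<psi> \<circ> ?mult \<circ> inv_into (U \<times> U) (map_prod \<psi> \<psi>))"
    using G U(1) unfolding lie_group_def smooth_map_def by blast
  moreover have "(p, p) \<in> map_prod \<psi> \<psi> ` (U \<times> U \<inter> ?mult -` U)"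
    using U(2) by (intro image_eqI[of _ _ "(\<one>, \<one>)"]) (auto simp: p_def)
  ultimately obtain W F where W: "open W" "(p, p) \<in> W" "\<And>n. times_cont_diff_on n W F"
    and F_on: "\<And>z. z \<in> map_prod \<psi> \<psi> ` (U \<times> U \<inter> ?mult -` U) \<inter> W \<Longrightarrow>
        F z = (\<psi> \<circ> ?mult \<circ> inv_into (U \<times> U) (map_prod \<psi> \<psi>)) z"
    unfolding smooth_on_def by metis
  have F: "F (\<psi> x, \<psi> y) = \<psi> (x \<otimes> y)" if "x \<in> U" "y \<in> U" "x \<otimes> y \<in> U" "(\<psi> x, \<psi> y) \<in> W" for x y
  proof -
    have "inv_into (U \<times> U) (map_prod \<psi> \<psi>) (map_prod \<psi> \<psi> (x, y)) = (x, y)"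
      using that inj by (intro inv_into_f_f map_prod_inj_on) auto
    moreover have "(\<psi> x, \<psi> y) \<in> map_prod \<psi> \<psi> ` (U \<times> U \<inter> ?mult -` U) \<inter> W"
      using that by (auto intro!: image_eqI[of _ _ "(x, y)"])
    ultimately show ?thesis using F_on[of "(\<psi> x, \<psi> y)"] by simp
  qed
  obtain r where r: "r > 0" "ball (p, p) r \<subseteq> W" using W open_contains_ball by blast
  have box: "(a, b) \<in> ball (p, p) s" if "norm (a - p) < s / 2" "norm (b - p) < s / 2" for a b s
    using that norm_Pair_le[of "p - a" "p - b"] by (simp add: dist_norm norm_minus_commute)
  obtain B where B: "openin T B" "\<one> \<in> B" "B \<subseteq> U" "\<And>y. y \<in> B \<Longrightarrow> norm (\<phi> y) < r / 2"
    using near[of "r / 2"] r(1) by auto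
  have inW: "(\<psi> x, \<psi> y) \<in> W" if "x \<in> B" "y \<in> B" for x y
    using box[of "\<psi> x" r "\<psi> y"] B(4) that r(2) by (auto simp: \<phi>_def)
  obtain D where D: "linear D" and strict: "\<And>\<epsilon>. \<epsilon> > 0 \<Longrightarrow> \<exists>\<delta>>0. \<forall>x\<in>ball (p, p) \<delta>. \<forall>y\<in>ball (p, p) \<delta>.
      norm (F y - F x - D (y - x)) \<le> \<epsilon> * norm (y - x)"
    using strict_derivative[OF W(1,2) W(3)] by metis
  \<comment> \<open>The group determines \<open>F\<close> only on pairs from the chart image, so
    \<open>D\<close> is tested along \<open>V\<close>. There \<one> y = y forces the identity, after
    v is scaled down until p + t v lies in the image of \<open>B\<close>.\<close>
  have D_snd: "D (0, v) = v" if v: "v \<in> V" for v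
  proof -
    have "norm (v - D (0, v)) \<le> \<epsilon> * norm v" if eps: "\<epsilon> > 0" for \<epsilon>
    proof -
      obtain \<delta> where \<delta>: "\<delta> > 0" "\<And>x y. x \<in> ball (p, p) \<delta> \<Longrightarrow> y \<in> ball (p, p) \<delta> \<Longrightarrow>
          norm (F y - F x - D (y - x)) \<le> \<epsilon> * norm (y - x)"
        using strict[OF eps] by blast
      obtain d where d: "d > 0" "\<And>v. v \<in> V \<Longrightarrow> norm v < d \<Longrightarrow> p + v \<in> \<psi> ` (B \<inter> U)"
        using nbhd[OF B(1,2)] by blast
      define c where "c = min d (\<delta> / 2)"
      \<comment> \<open>Positive even for v = 0 and at least norm v, so t v has norm at most
        c/2.\<close>
      define n where "n = norm v + 1"
      define t where "t = c / (2 * n)"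
      have n: "n > 0" by (simp add: n_def add_nonneg_pos)
      have c: "c > 0" "c \<le> d" "c \<le> \<delta> / 2" using d \<delta> by (auto simp: c_def)
      have t: "t > 0" using c n by (simp add: t_def)
      have "norm (t *\<^sub>R v) \<le> t * n" using t by (simp add: n_def)
      also have "\<dots> = c / 2" using n by (simp add: t_def)
      also have "\<dots> < c" using c by simp
      finally have tv: "norm (t *\<^sub>R v) < d" "norm (t *\<^sub>R v) < \<delta> / 2" using c by auto
      then obtain y where y: "y \<in> B" "\<psi> y = p + t *\<^sub>R v"
        using d(2)[of "t *\<^sub>R v"] V(1) v by (auto simp: subspace_scale)
      have yU: "y \<in> U" "y \<in> carrier G" using y B(3) UG by auto
      have "F (p, p + t *\<^sub>R v) = p + t *\<^sub>R v"
        using F[of \<one> y] inW[OF B(2) y(1)] yU U(2) by (simp add: p_def[symmetric] y(2))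
      moreover have "F (p, p) = p"
        using F[of \<one> \<one>] W(2) U(2) by (simp add: p_def[symmetric])
      moreover have "norm (F (p, p + t *\<^sub>R v) - F (p, p) - D ((p, p + t *\<^sub>R v) - (p, p)))
          \<le> \<epsilon> * norm ((p, p + t *\<^sub>R v) - (p, p))"
        using tv(2) \<delta>(1) by (intro \<delta>(2) box) auto
      moreover have "D (0, t *\<^sub>R v) = t *\<^sub>R D (0, v)"
        using linear_scale[OF D, of t "(0, v)"] by simp
      ultimately have "norm (t *\<^sub>R (v - D (0, v))) \<le> \<epsilon> * norm (t *\<^sub>R v)"
        by (simp add: scaleR_diff_right norm_Pair)
      then show ?thesis using t by (simp add: mult.left_commute)
    qed
    note bound = this
    show ?thesis
    proof (cases "v = 0")
      case True
      then show ?thesis using linear_0[OF D] by (simp add: zero_prod_def)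
    next
      case False
      have "norm (v - D (0, v)) \<le> 0"
      proof (rule field_le_epsilon)
        fix e :: real assume "e > 0"
        then show "norm (v - D (0, v)) \<le> 0 + e" using bound[of "e / norm v"] False by simp
      qed
      then show ?thesis by simp
    qed
  qed
  obtain C where C: "openin T C" "\<one> \<in> C" "\<And>x y. x \<in> C \<Longrightarrow> y \<in> C \<Longrightarrow> inv x \<otimes> y \<in> U"
    using division_neighbourhood[OF openU U(2)] by metis
  \<comment> \<open>Inverses are included because \<open>C\<close> controls quotients: x y is the
    quotient of y by the inverse of x.\<close>
  let ?C = "{x \<in> carrier G. inv x \<in> C} \<inter> C \<inter> B"
  have C': "openin T ?C" "\<one> \<in> ?C" using C(1,2) B(1,2) openin_preimage_inv by auto
  have mult_in: "x \<otimes> y \<in> U" if "x \<in> ?C" "y \<in> ?C" for x y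
    using C(3)[of "inv x" y] that by simp
  have "chart_at_identity G T U \<phi>"
  proof
    show "openin T U" "\<one> \<in> U" "\<phi> \<one> = 0" using openU U(2) by (auto simp: \<phi>_def p_def)
    show "\<exists>\<delta>>0. \<forall>y\<in>U. norm (\<phi> y) < \<delta> \<longrightarrow> y \<in> W" if "openin T W" "\<one> \<in> W" for W
      using small that by blast
    show "\<exists>W. openin T W \<and> \<one> \<in> W \<and> W \<subseteq> U \<and> (\<forall>y\<in>W. norm (\<phi> y) < \<delta>)" if "\<delta> > 0" for \<delta>
      using near that by blast
    show "\<exists>\<delta>>0. \<forall>x\<in>U. \<forall>y\<in>U. norm (\<phi> x) < \<delta> \<longrightarrow> norm (\<phi> y) < \<delta> \<longrightarrow>
        x \<otimes> y \<in> U \<and> norm (\<phi> (x \<otimes> y) - \<phi> x - \<phi> y) \<le> \<epsilon> * norm (\<phi> y)" if eps: "\<epsilon> > 0" for \<epsilon>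
    proof -
      obtain \<delta> where \<delta>: "\<delta> > 0" "\<And>x y. x \<in> ball (p, p) \<delta> \<Longrightarrow> y \<in> ball (p, p) \<delta> \<Longrightarrow>
          norm (F y - F x - D (y - x)) \<le> \<epsilon> * norm (y - x)"
        using strict[OF eps] by blast
      obtain d where d: "d > 0" "\<And>y. y \<in> U \<Longrightarrow> norm (\<phi> y) < d \<Longrightarrow> y \<in> ?C"
        using small[OF C'] by blast
      have "x \<otimes> y \<in> U \<and> norm (\<phi> (x \<otimes> y) - \<phi> x - \<phi> y) \<le> \<epsilon> * norm (\<phi> y)"
        if xy: "x \<in> U" "y \<in> U" "norm (\<phi> x) < min d (\<delta> / 2)" "norm (\<phi> y) < min d (\<delta> / 2)" for x y
      proof
        have xyC: "x \<in> ?C" "y \<in> ?C" using d(2) xy by auto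
        then show xyU: "x \<otimes> y \<in> U" by (rule mult_in)
        \<comment> \<open>The first argument is the same in both points, so the error is relative to
          the displacement of y alone, as \<open>mult_approx\<close> demands.\<close>
        have "norm (F (\<psi> x, \<psi> y) - F (\<psi> x, p) - D ((\<psi> x, \<psi> y) - (\<psi> x, p))) \<le> \<epsilon> * norm ((\<psi> x, \<psi> y) - (\<psi> x, p))"
          using xy \<delta>(1) by (intro \<delta>(2) box) (auto simp: \<phi>_def)
        moreover have "F (\<psi> x, \<psi> y) = \<psi> (x \<otimes> y)" using xyC xy xyU inW by (intro F) auto
        moreover have "F (\<psi> x, p) = \<psi> x"
          using F[of x \<one>] xy(1) U(2) inW[of x \<one>] B(2) xyC by (simp add: p_def)
        moreover have "D ((\<psi> x, \<psi> y) - (\<psi> x, p)) = \<phi> y"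
          using D_snd[OF \<phi>V[OF xy(2)]] by (simp add: \<phi>_def)
        ultimately have "norm (\<psi> (x \<otimes> y) - \<psi> x - \<phi> y) \<le> \<epsilon> * norm ((\<psi> x, \<psi> y) - (\<psi> x, p))" by simp
        then show "norm (\<phi> (x \<otimes> y) - \<phi> x - \<phi> y) \<le> \<epsilon> * norm (\<phi> y)"
          by (simp add: \<phi>_def norm_Pair)
      qed
      then show ?thesis using d(1) \<delta>(1) by (intro exI[of _ "min d (\<delta> / 2)"]) auto
    qed
    show "\<exists>W. openin T W \<and> \<one> \<in> W \<and> (\<forall>x\<in>W. \<exists>D f.
      (f has_derivative D) (at 0) \<and> f 0 = 0 \<and>
      (\<exists>\<delta>>0. \<forall>y\<in>U. norm (\<phi> y) < \<delta> \<longrightarrow>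
        x \<otimes> y \<otimes> inv x \<in> U \<and> \<phi> (x \<otimes> y \<otimes> inv x) = f (\<phi> y)))"
    proof (intro exI[of _ "{x \<in> carrier G. inv x \<in> B} \<inter> B"] conjI ballI)
      show "openin T ({x \<in> carrier G. inv x \<in> B} \<inter> B)" "\<one> \<in> {x \<in> carrier G. inv x \<in> B} \<inter> B"
        using B(1,2) openin_preimage_inv by auto
      \<comment> \<open>Since x and its inverse both lie in \<open>B\<close>, both have coordinates,
        and the pairs formed with points of \<open>B\<close> lie in the domain \<open>W\<close> of
        \<open>F\<close>.\<close>
      fix x assume x: "x \<in> {x \<in> carrier G. inv x \<in> B} \<inter> B"
      then have xU: "x \<in> U" "inv x \<in> U" "x \<in> carrier G" using B(3) by auto
      have diff: "\<exists>E. (F has_derivative E) (at z)" if "z \<in> W" for z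
        using W(3)[of 1] that by (auto simp: differentiable_def)
      have Fx: "F (\<psi> x, p) = \<psi> x"
        using F[of x \<one>] xU U(2) inW[of x \<one>] B(2) x by (simp add: p_def)
      obtain E1 where E1: "(F has_derivative E1) (at (\<psi> x, p))"
        using diff[of "(\<psi> x, p)"] inW[of x \<one>] x B(2) by (auto simp: p_def)
      obtain E2 where E2: "(F has_derivative E2) (at (\<psi> x, \<psi> (inv x)))"
        using diff[of "(\<psi> x, \<psi> (inv x))"] inW[of x "inv x"] x by auto
      \<comment> \<open>Conjugation by x in centred coordinates: multiply by x on the left, then by
        its inverse on the right. At b = 0 the inner value is \<psi> x, which is why the outer
        derivative \<open>E2\<close> is taken there.\<close>
      define f where "f b = F (F (\<psi> x, p + b), \<psi> (inv x)) - p" for b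
      have "((\<lambda>b. (\<psi> x, p + b)) has_derivative (\<lambda>v. (0, v))) (at 0)"
        by (auto intro!: derivative_eq_intros)
      from has_derivative_compose[OF this] E1
      have "((\<lambda>b. F (\<psi> x, p + b)) has_derivative (\<lambda>v. E1 (0, v))) (at 0)" by simp
      then have "((\<lambda>b. (F (\<psi> x, p + b), \<psi> (inv x))) has_derivative (\<lambda>v. (E1 (0, v), 0))) (at 0)"
        by (auto intro!: derivative_eq_intros)
      from has_derivative_compose[OF this] E2 Fx
      have "((\<lambda>b. F (F (\<psi> x, p + b), \<psi> (inv x))) has_derivative (\<lambda>v. E2 (E1 (0, v), 0))) (at 0)" by simp
      then have der: "(f has_derivative (\<lambda>v. E2 (E1 (0, v), 0))) (at 0)"
        unfolding f_def by (auto intro!: derivative_eq_intros)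
      have f0: "f 0 = 0"
      proof -
        have "f 0 = F (\<psi> x, \<psi> (inv x)) - p" by (simp add: f_def Fx)
        also have "F (\<psi> x, \<psi> (inv x)) = p"
          using F[of x "inv x"] xU U(2) inW[of x "inv x"] x by (simp add: p_def)
        finally show ?thesis by simp
      qed
      \<comment> \<open>For y here, both applications of \<open>F\<close> have arguments in
        \<open>W\<close>, and the conjugate lies in \<open>U\<close>.\<close>
      define Y where "Y = {y \<in> carrier G. x \<otimes> y \<in> B} \<inter>
        {y \<in> carrier G. x \<otimes> y \<in> {z \<in> carrier G. z \<otimes> inv x \<in> U}} \<inter> B"
      have openY: "openin T Y" unfolding Y_def using xU B(1) openU
        by (intro openin_Int openin_preimage_ltrans openin_preimage_rtrans) auto
      have oneY: "\<one> \<in> Y" unfolding Y_def using x xU B(2) U(2) by simp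
      obtain \<delta> where \<delta>: "\<delta> > 0" "\<And>y. y \<in> U \<Longrightarrow> norm (\<phi> y) < \<delta> \<Longrightarrow> y \<in> Y"
        using small[OF openY oneY] by blast
      have "x \<otimes> y \<otimes> inv x \<in> U \<and> \<phi> (x \<otimes> y \<otimes> inv x) = f (\<phi> y)" if "y \<in> U" "norm (\<phi> y) < \<delta>" for y
      proof -
        have y: "y \<in> carrier G" "x \<otimes> y \<in> B" "x \<otimes> y \<otimes> inv x \<in> U" "y \<in> B"
          using \<delta>(2)[OF that] by (auto simp: Y_def)
        have "F (\<psi> x, \<psi> y) = \<psi> (x \<otimes> y)" using x y xU B(3) inW[of x y] by (intro F) auto
        moreover have "F (\<psi> (x \<otimes> y), \<psi> (inv x)) = \<psi> (x \<otimes> y \<otimes> inv x)"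
          using x y xU B(3) inW[of "x \<otimes> y" "inv x"] by (intro F) auto
        ultimately show ?thesis using y by (simp add: f_def \<phi>_def)
      qed
      then show "\<exists>D f. (f has_derivative D) (at 0) \<and> f 0 = 0 \<and>
        (\<exists>\<delta>>0. \<forall>y\<in>U. norm (\<phi> y) < \<delta> \<longrightarrow> x \<otimes> y \<otimes> inv x \<in> U \<and> \<phi> (x \<otimes> y \<otimes> inv x) = f (\<phi> y))"
        using der f0 \<delta>(1) by blast
    qed
  qed
  then show thesis by (rule that)
qed

section \<open>Density of power maps\<close>

lemma has_dense_image_iff:
  "has_dense_image X f \<longleftrightarrow> (\<forall>W. openin X W \<longrightarrow> W \<noteq> {} \<longrightarrow> (\<exists>x\<in>topspace X. f x \<in> W))"
  unfolding has_dense_image_def dense_intersects_open by blast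

lemma (in normal) FactGroup_nat_pow_coset:
  assumes "g \<in> carrier G"
  shows "(H #> g) [^]\<^bsub>G Mod H\<^esub> (k::nat) = H #> (g [^] k)"
proof -
  interpret Q: group "G Mod H" by (rule factorgroup_is_group)
  show ?thesis
  proof (induction k)
    case 0
    show ?case by (simp add: FactGroup_def coset_mult_one[OF subset])
  next
    case (Suc k)
    then show ?case using assms by (simp add: rcos_sum)
  qed
qed

theorem proposition3p3:
  fixes G :: "('a, 'm) monoid_scheme"
    and T :: "'a topology"
    and A :: "('a, 'e::euclidean_space) chart set"
    and R :: "'a set"
    and k :: nat
  assumes "lie_group G T A"
    and "connected_space T"
    and "is_radical G T R"
    and "k > 0"
  shows "has_dense_image T (\<lambda>g. g [^]\<^bsub>G\<^esub> k) \<longleftrightarrow>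
         has_dense_image (coset_topology G T R) (\<lambda>x. x [^]\<^bsub>G Mod R\<^esub> k)"
proof -
  obtain U and \<phi> :: "'a \<Rightarrow> 'e" where chart: "chart_at_identity G T U \<phi>"
    using lie_group_chart_at_identity[OF assms(1)] .
  interpret chart_at_identity G T U \<phi> by fact
  interpret connected_chart G T U \<phi>
    using assms(2) topspace_eq by unfold_locales (metis connectedin_topspace)
  have haus: "Hausdorff_space T" using assms(1) by (simp add: lie_group_def smooth_manifold_def)
  have R: "R \<lhd> G" "connectedin T R" "solvable (G\<lparr>carrier := R\<rparr>)"
    using assms(3) by (auto simp: is_radical_def connected_solvable_normal_def)
  interpret R: normal R G by fact
  let ?q = "\<lambda>g. R #>\<^bsub>G\<^esub> g"
  have openq: "openin (coset_topology G T R) W \<longleftrightarrow> W \<subseteq> ?q ` carrier G \<and> openin T {x \<in> carrier G. ?q x \<in> W}" for W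
    by (simp add: coset_topology_def openin_quotient_topology)
  have topq: "topspace (coset_topology G T R) = ?q ` carrier G"
    by (simp add: coset_topology_def)
  have denseT: "has_dense_image T (\<lambda>g. g [^]\<^bsub>G\<^esub> k) \<longleftrightarrow> dense_powers_modulo k {\<one>\<^bsub>G\<^esub>}"
    unfolding has_dense_image_iff dense_powers_modulo_def by simp
  show ?thesis
  proof
    assume dense: "has_dense_image T (\<lambda>g. g [^]\<^bsub>G\<^esub> k)"
    show "has_dense_image (coset_topology G T R) (\<lambda>x. x [^]\<^bsub>G Mod R\<^esub> k)"
      unfolding has_dense_image_iff
    proof (intro allI impI)
      fix W assume W: "openin (coset_topology G T R) W" "W \<noteq> {}"
      then have "openin T {x \<in> carrier G. ?q x \<in> W}" "{x \<in> carrier G. ?q x \<in> W} \<noteq> {}"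
        unfolding openq by auto
      then obtain x where x: "x \<in> carrier G" "x [^]\<^bsub>G\<^esub> k \<in> {x \<in> carrier G. ?q x \<in> W}"
        using dense unfolding has_dense_image_iff topspace_eq by blast
      then have "?q x [^]\<^bsub>G Mod R\<^esub> k \<in> W" by (simp add: R.FactGroup_nat_pow_coset)
      then show "\<exists>x\<in>topspace (coset_topology G T R). x [^]\<^bsub>G Mod R\<^esub> k \<in> W"
        unfolding topq using x(1) by blast
    qed
  next
    assume dense: "has_dense_image (coset_topology G T R) (\<lambda>x. x [^]\<^bsub>G Mod R\<^esub> k)"
    have "dense_powers_modulo k R"
      unfolding dense_powers_modulo_def
    proof (intro allI impI)
      fix W assume W: "openin T W" "W \<noteq> {}"
      have WG: "W \<subseteq> carrier G" using openin_subset[OF W(1)] by simp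
      \<comment> \<open>The quotient map is open: the saturation of \<open>W\<close> is a union of
        translates of \<open>W\<close>. This turns density in the quotient into density modulo
        \<open>R\<close>.\<close>
      have saturated: "{x \<in> carrier G. ?q x \<in> ?q ` W} = (\<Union>m\<in>R. {x \<in> carrier G. m \<otimes>\<^bsub>G\<^esub> x \<in> W})"
      proof (intro equalityI subsetI)
        fix x assume "x \<in> {x \<in> carrier G. ?q x \<in> ?q ` W}"
        then obtain w where w: "x \<in> carrier G" "w \<in> W" "?q x = ?q w" by blast
        have "w \<in> ?q w" using WG w(2) by (intro rcos_self R.subgroup_axioms) auto
        then have "w \<in> ?q x" by (simp only: w(3))
        then obtain m where "m \<in> R" "w = m \<otimes>\<^bsub>G\<^esub> x" unfolding r_coset_def by blast
        then show "x \<in> (\<Union>m\<in>R. {x \<in> carrier G. m \<otimes>\<^bsub>G\<^esub> x \<in> W})"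
          using w(1,2) by blast
      next
        fix x assume "x \<in> (\<Union>m\<in>R. {x \<in> carrier G. m \<otimes>\<^bsub>G\<^esub> x \<in> W})"
        then obtain m where m: "m \<in> R" "x \<in> carrier G" "m \<otimes>\<^bsub>G\<^esub> x \<in> W" by blast
        then have "m \<otimes>\<^bsub>G\<^esub> x \<in> ?q x" unfolding r_coset_def by blast
        then have "?q x = ?q (m \<otimes>\<^bsub>G\<^esub> x)"
          using m(2) by (intro repr_independence R.subgroup_axioms)
        then show "x \<in> {x \<in> carrier G. ?q x \<in> ?q ` W}" using m by blast
      qed
      have "openin T (\<Union>m\<in>R. {x \<in> carrier G. m \<otimes>\<^bsub>G\<^esub> x \<in> W})"
        using W(1) by (intro openin_Union) (auto intro: openin_preimage_ltrans)
      then have "openin (coset_topology G T R) (?q ` W)"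
        unfolding openq saturated using WG by blast
      then obtain g where g: "g \<in> carrier G" "?q g [^]\<^bsub>G Mod R\<^esub> k \<in> ?q ` W"
        using dense W(2) unfolding has_dense_image_iff topq by blast
      then have "g [^]\<^bsub>G\<^esub> k \<in> {x \<in> carrier G. ?q x \<in> ?q ` W}"
        by (simp add: R.FactGroup_nat_pow_coset)
      then show "\<exists>x\<in>carrier G. \<exists>m\<in>R. m \<otimes>\<^bsub>G\<^esub> x [^]\<^bsub>G\<^esub> k \<in> W"
        unfolding saturated using g(1) by blast
    qed
    then show "has_dense_image T (\<lambda>g. g [^]\<^bsub>G\<^esub> k)"
      unfolding denseT by (rule dense_powers_of_solvable[OF haus R assms(4)])
  qed
qed

end
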